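(* Assume the standing setup below and $\beta_n n^{-\alpha}\to0$. Then for every fixed $i\ge1$, $A_{(i)}\to0$ in probability. Suppose in addition $\beta_n\to\infty$, set $m_n(q)=C(q)\,n\,\beta_n^{-1/\alpha}$, and let $(k_n)$ be positive integers with $k_n/m_n(q)\to x\in[0,\infty)$. Then, in probability, (i) $A_{(k_n)}/A_{(1)}\to\exp(-x^\alpha)$; (ii) $m_n(q)\,A_{(k_n)}\to \exp(-x^\alpha)/\Gamma(\tfrac1\alpha+1)$; (iii) $\sum_{i=1}^{k_n}A_{(i)}\to \gamma_{\rm inc}(\tfrac1\alpha,x^\alpha)/\Gamma(\tfrac1\alpha)$, where $\gamma_{\rm inc}(s,z)=\int_0^z u^{s-1}e^{-u}\,du$ is the lower incomplete gamma function.
   Context: Standing setup: Fix an integer $d\ge 2$; let $\mathbb S^{d-1}\subset\mathbb R^d$ be the unit sphere with surface measure $\sigma$. Fix $q\in\mathbb S^{d-1}$. Let $x_1,x_2,\dots$ be i.i.d. random vectors on $\mathbb S^{d-1}$ with law $\rho(x)\,d\sigma(x)$, where $\rho$ is a $C^2$ probability density on $\mathbb S^{d-1}$ with $\rho(q)>0$. Let $(\beta_n)_{n\ge1}$ be positive reals and set $\alpha=2/(d-1)$. Define $T_i=1-\langle q,x_i\rangle\in[0,2]$, $Z_n=\sum_{j=1}^n e^{-\beta_nT_j}$, attention weights $A_i=e^{-\beta_nT_i}/Z_n$ ($1\le i\le n$), and let $A_{(1)}\ge\cdots\ge A_{(n)}$ be their decreasing rearrangement. Let $C(q)=\frac{2^{1/\alpha}\sigma_{d-2}}{d-1}\rho(q)$,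 where $\sigma_{d-2}$ is the surface area of $\mathbb S^{d-2}$. *)

theory Defs
  imports "HOL-Probability.Probability"
begin

text \<open>Surface measure on the unit sphere of the Euclidean space real^'d, defined by the
  cone construction: sigma(A) = d * lebesgue volume of {y : 0 < norm y <= 1, y / norm y in A}.\<close>
definition sphere_measure :: "(real^'d::finite) measure" where
  "sphere_measure =
     density (distr (restrict_space lborel (cball 0 1 - {0})) borel (\<lambda>y. y /\<^sub>R norm y))
             (\<lambda>_. ennreal (real CARD('d)))"

text \<open>Surface area of the unit sphere S^k in R^(k+1): 2 pi^((k+1)/2) / Gamma((k+1)/2).\<close>
definition sphere_area :: "nat \<Rightarrow> real" where
  "sphere_area k = 2 * pi powr ((real k + 1) / 2) / Gamma ((real k + 1) / 2)"

definition lower_inc_gamma :: "real \<Rightarrow> real \<Rightarrow> real" where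
  "lower_inc_gamma s z = (LBINT u=0..z. u powr (s - 1) * exp (- u))"

definition conv_in_prob :: "'a measure \<Rightarrow> (nat \<Rightarrow> 'a \<Rightarrow> real) \<Rightarrow> real \<Rightarrow> bool" where
  "conv_in_prob M Y c \<longleftrightarrow>
     (\<forall>e>0. (\<lambda>n. measure M {\<omega> \<in> space M. e < \<bar>Y n \<omega> - c\<bar>}) \<longlonglongrightarrow> 0)"

definition attn :: "real \<Rightarrow> 'v::real_inner \<Rightarrow> (nat \<Rightarrow> 'v) \<Rightarrow> nat \<Rightarrow> nat \<Rightarrow> real" where
  "attn \<beta> q x n i =
     exp (- \<beta> * (1 - inner q (x i))) / (\<Sum>j=1..n. exp (- \<beta> * (1 - inner q (x j))))"

definition ordstat :: "nat \<Rightarrow> (nat \<Rightarrow> real) \<Rightarrow> nat \<Rightarrow> real" where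
  "ordstat n a k = (if 1 \<le> k \<and> k \<le> n then rev (sort (map a [1..<Suc n])) ! (k - 1) else 0)"

definition ord_attn :: "real \<Rightarrow> 'v::real_inner \<Rightarrow> (nat \<Rightarrow> 'v) \<Rightarrow> nat \<Rightarrow> nat \<Rightarrow> real" where
  "ord_attn \<beta> q x n k = ordstat n (attn \<beta> q x n) k"

end

theory Submission
  imports Defs
begin

text \<open>
  Near \<open>q\<close> the sphere looks like a cone over a flat disc, so Fubini gives
  \<open>P (T \<le> t) \<sim> C(q) t\<^sup>s\<close> as \<open>t \<rightarrow> 0\<close>, with \<open>s = 1 / \<alpha> = (d - 1) / 2\<close>. Hence, at scale \<open>1 / \<beta>\<^sub>n\<close>, each of
  the partition sum, the number of points with \<open>\<beta>\<^sub>n T\<^sub>j \<le> y\<close> and the partial sum of \<open>exp (- \<beta>\<^sub>n T\<^sub>j)\<close>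
  over these points is a sum of i.i.d. variables with values in \<open>[0, 1]\<close> and with mean of order
  \<open>m\<^sub>n \<rightarrow> \<infinity>\<close>; its variance is at most its mean, so Chebyshev's inequality shows that it
  concentrates after division by \<open>m\<^sub>n\<close>. The limits are \<open>\<Gamma>(s + 1)\<close>, \<open>y\<^sup>s\<close> and
  \<open>s \<gamma>(s, y)\<close>. A rank \<open>k\<^sub>n \<sim> x m\<^sub>n\<close> therefore lies between the counts for \<open>y < x\<^sup>\<alpha>\<close> and
  \<open>y > x\<^sup>\<alpha>\<close>, which squeezes the order statistics and the partial sums of the weights.
\<close>

section \<open>Small spherical caps\<close>

text \<open>The cone construction of \<open>sphere_measure\<close> turns a cap into a solid sector
  with a rounded lid. Two cones with flat lids, at heights \<open>1 - t\<close> and 1, enclose it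
  from inside and outside; their volumes differ only by a factor (1 - t)^d, so no surface integral
  is computed. To leading order the cap is a flat disc of dimension d - 1 and radius sqrt (2 t), of
  volume V (2 t)^s with V the volume of the unit ball; since V = sigma_(d-2) / (d - 1), this is the
  origin of C(q).

  The denominator Z is random but common to all weights. Thresholds are therefore put on Z A_(k),
  where the level e^(-y) means \<beta> T <= y, a condition free of Z; only at the end is Z divided
  out. As level y is reached by about m y^s points, rank x m sits at y = x^(1/s) = x^\<alpha>.

  The vanishing of A_(i) must also cover bounded \<beta>, where the behaviour of the law at 0 does
  not give the order of the counts. There the count of points with \<beta> T <= 1 is normalised by
  its own mean, for which a lower bound suffices.\<close>

lemma vimage_ball_orthogonal_transformation:
  fixes f :: "'a::euclidean_space \<Rightarrow> 'a"
  assumes "orthogonal_transformation f"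
  shows "f -` ball (f c) r = ball c r"
  using assms by (auto simp: orthogonal_transformation_isometry)

text \<open>By Vitali, disjoint balls fill an open set up to a null set, and an isometry pulls each
  ball back to a ball of the same radius, hence of the same volume. Only an inequality results,
  because nothing is known yet about the preimage of the null remainder.\<close>

lemma emeasure_lborel_le_vimage_orthogonal:
  fixes f :: "'a::euclidean_space \<Rightarrow> 'a"
  assumes f: "orthogonal_transformation f" and U: "open U"
  shows "emeasure lborel U \<le> emeasure lborel (f -` U)"
proof -
  have contf: "continuous_on UNIV f"
    using f by (simp add: linear_continuous_on linear_linear orthogonal_transformation_linear)
  have fm[measurable]: "f \<in> borel_measurable borel"
    by (rule borel_measurable_continuous_onI[OF contf])
  define K where "K = {(x::'a, r::real). 0 < r \<and> ball x r \<subseteq> U}"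
  have ex: "\<exists>i. i \<in> K \<and> x \<in> ball (fst i) (snd i) \<and> snd i < d" if x: "x \<in> U" and d: "0 < d" for x d
  proof -
    obtain e where e: "e > 0" "ball x e \<subseteq> U"
      using U x by (auto simp: open_contains_ball)
    \<comment> \<open>Halving makes the radius strictly smaller than \<open>d\<close>, as a fine
      cover requires.\<close>
    have "ball x (min e (d/2)) \<subseteq> U" using e by auto
    with e d show ?thesis
      by (intro exI[of _ "(x, min e (d/2))"]) (auto simp: K_def)
  qed
  obtain C where C: "countable C" "C \<subseteq> K"
     "pairwise (\<lambda>i j. disjnt (ball (fst i) (snd i)) (ball (fst j) (snd j))) C"
     "negligible (U - (\<Union>i \<in> C. ball (fst i) (snd i)))"
    by (rule Vitali_covering_theorem_balls[of U K fst snd]) (use ex in blast)+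
  define B where "B i = ball (fst i :: 'a) (snd i :: real)" for i
  have disj: "disjoint_family_on B C"
    using C(3) by (auto simp: disjoint_family_on_def pairwise_def disjnt_def B_def)
  have subU: "(\<Union>i\<in>C. B i) \<subseteq> U" using C(2) by (fastforce simp: K_def B_def)
  have [measurable]: "B i \<in> sets borel" for i by (simp add: B_def)
  have [measurable]: "(\<Union>i\<in>C. B i) \<in> sets borel"
    using C(1) by (intro sets.countable_UN'') auto
  have [measurable]: "U \<in> sets borel" using U by simp
  have null: "U - (\<Union>i\<in>C. B i) \<in> null_sets lborel"
    using C(4) null_sets_completion_iff[of "U - (\<Union>i\<in>C. B i)" lborel]
    by (simp add: B_def[symmetric] negligible_iff_null_sets)
  have "emeasure lborel U = emeasure lborel ((\<Union>i\<in>C. B i) \<union> (U - (\<Union>i\<in>C. B i)))"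
    using subU by (simp add: Un_absorb1)
  also have "\<dots> = emeasure lborel (\<Union>i\<in>C. B i)"
    by (rule emeasure_Un_null_set[OF _ null]) simp
  also have "\<dots> = (\<integral>\<^sup>+i. emeasure lborel (B i) \<partial>count_space C)"
    by (rule emeasure_UN_countable[OF _ C(1) disj]) simp
  also have "\<dots> = (\<integral>\<^sup>+i. emeasure lborel (f -` B i) \<partial>count_space C)"
  proof (rule nn_integral_cong)
    fix i assume "i \<in> space (count_space C)"
    then have r: "snd i > 0" using C(2) by (auto simp: K_def)
    obtain c where c: "fst i = f c"
      using orthogonal_transformation_surj[OF f] by (metis surjD)
    show "emeasure lborel (B i) = emeasure lborel (f -` B i)"
      unfolding B_def c vimage_ball_orthogonal_transformation[OF f]
      using r by (simp add: emeasure_ball)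
  qed
  also have "\<dots> = emeasure lborel (\<Union>i\<in>C. f -` B i)"
  proof (rule emeasure_UN_countable[symmetric, OF _ C(1)])
    show "disjoint_family_on (\<lambda>i. f -` B i) C"
      using disj unfolding disjoint_family_on_def by blast
    show "f -` B i \<in> sets lborel" if "i \<in> C" for i
      using measurable_sets[OF fm, of "B i"] by simp
  qed
  also have "\<dots> \<le> emeasure lborel (f -` U)"
    using subU measurable_sets[OF fm, of U] by (intro emeasure_mono) auto
  finally show ?thesis .
qed

text \<open>The inequality for \<open>f\<close> and the one for its inverse give equality on boxes,
  which determine Lebesgue measure.\<close>

lemma lborel_distr_orthogonal_transformation:
  fixes f :: "'a::euclidean_space \<Rightarrow> 'a"
  assumes f: "orthogonal_transformation f"
  shows "distr lborel borel f = lborel"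
proof (rule lborel_eqI[symmetric])
  fix l u :: 'a
  assume le: "\<And>b. b \<in> Basis \<Longrightarrow> l \<bullet> b \<le> u \<bullet> b"
  have contf: "continuous_on UNIV f"
    using f by (simp add: linear_continuous_on linear_linear orthogonal_transformation_linear)
  have fm[measurable]: "f \<in> borel_measurable borel"
    by (rule borel_measurable_continuous_onI[OF contf])
  have g: "orthogonal_transformation (inv f)"
    using f by (rule orthogonal_transformation_inv)
  have op: "open (f -` box l u)"
    by (rule open_vimage[OF open_box contf])
  have *: "inv f -` (f -` box l u) = box l u"
    using orthogonal_transformation_surj[OF f] by (auto simp: surj_f_inv_f)
  have "emeasure lborel (f -` box l u) \<le> emeasure lborel (box l u)"
    using emeasure_lborel_le_vimage_orthogonal[OF g op] unfolding * .
  moreover have "emeasure lborel (box l u) \<le> emeasure lborel (f -` box l u)"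
    by (rule emeasure_lborel_le_vimage_orthogonal[OF f open_box])
  ultimately have "emeasure (distr lborel borel f) (box l u) = emeasure lborel (box l u)"
    by (simp add: emeasure_distr)
  then show "emeasure (distr lborel borel f) (box l u) = (\<Prod>b\<in>Basis. (u - l) \<bullet> b)"
    using le by (simp add: emeasure_lborel_box_eq prod_ennreal inner_diff_left)
qed simp

text \<open>A cone with apex 0 (excluded), axis \<open>q\<close> and slope \<open>\<tau>\<close>.
  The lid at height \<open>a\<close> is flat, so that every slice orthogonal to \<open>q\<close> is
  a full ball.\<close>

definition solid_cone :: "'a::real_inner \<Rightarrow> real \<Rightarrow> real \<Rightarrow> 'a set" where
  "solid_cone q a \<tau> = {y. 0 < y \<bullet> q \<and> y \<bullet> q \<le> a \<and> norm (y - (y \<bullet> q) *\<^sub>R q) \<le> \<tau> * (y \<bullet> q)}"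

lemma solid_cone_borel [measurable]: "solid_cone (q::'a::euclidean_space) a \<tau> \<in> sets borel"
  unfolding solid_cone_def by measurable

lemma nn_integral_power_Icc:
  assumes "a \<ge> 0" "0 < n"
  shows "(\<integral>\<^sup>+y. ennreal (indicator {0..a} y * y ^ (n - 1)) \<partial>lborel) = ennreal (a ^ n / n)"
proof -
  have "((\<lambda>y. y ^ (n - 1)) has_integral (a ^ n / n - 0 ^ n / n)) {0..a}"
    using assms
    by (intro fundamental_theorem_of_calculus)
       (auto intro!: derivative_eq_intros simp flip: has_real_derivative_iff_has_vector_derivative)
  then have "((\<lambda>y. y ^ (n - 1)) has_integral (a ^ n / n)) {0..a}"
    using zero_power[OF assms(2), where ?'a=real]
    by simp
  from nn_integral_has_integral_lebesgue[OF _ this]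
  show ?thesis by (simp add: mult.commute)
qed

text \<open>With a basis vector as axis the height h is a single coordinate, and the slice at height
  h is a ball of radius \<tau> h in dimension d - 1. Integrating V (\<tau> h)^(d-1) over 0 < h <= a
  gives the formula.\<close>

lemma emeasure_solid_cone_Basis:
  fixes e :: "'a::euclidean_space"
  assumes e: "e \<in> Basis" and pos: "a > 0" "\<tau> > 0"
  shows "emeasure lborel (solid_cone e a \<tau>) =
    ennreal (unit_ball_vol (DIM('a) - 1) * \<tau> ^ (DIM('a) - 1) * a ^ DIM('a) / DIM('a))"
proof -
  interpret product_sigma_finite "\<lambda>_::'a. lborel :: real measure"
    by standard
  define B where "B = Basis - {e}"
  have B: "finite B" "e \<notin> B" "(Basis::'a set) = insert e B" "card B = DIM('a) - 1"
    using e by (auto simp: B_def)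
  define S where "S = {f :: 'a \<Rightarrow> real. 0 < f e \<and> f e \<le> a \<and> sqrt (\<Sum>b\<in>B. (f b)\<^sup>2) \<le> \<tau> * f e}"
  define P where "P = (Pi\<^sub>M (insert e B) (\<lambda>_. lborel :: real measure))"
  have in_cone: "(\<Sum>b\<in>Basis. f b *\<^sub>R b) \<in> solid_cone e a \<tau> \<longleftrightarrow> f \<in> S" for f
  proof -
    let ?y = "\<Sum>b\<in>Basis. f b *\<^sub>R b"
    have i: "?y \<bullet> b = f b" if "b \<in> Basis" for b
      using that by (simp add: inner_sum_left inner_Basis if_distrib sum.delta cong: if_cong)
    have "(norm (?y - (?y \<bullet> e) *\<^sub>R e))\<^sup>2 = (\<Sum>b\<in>Basis. ((?y - (?y \<bullet> e) *\<^sub>R e) \<bullet> b)\<^sup>2)"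
      unfolding power2_norm_eq_inner by (subst euclidean_inner) (simp add: power2_eq_square)
    also have "\<dots> = (\<Sum>b\<in>insert e B. (f b - f e * (e \<bullet> b))\<^sup>2)"
      unfolding B(3)[symmetric] using e i by (intro sum.cong) (auto simp: inner_diff_left)
    also have "\<dots> = (\<Sum>b\<in>B. (f b)\<^sup>2)"
    proof -
      have "(\<Sum>b\<in>B. (f b - f e * (e \<bullet> b))\<^sup>2) = (\<Sum>b\<in>B. (f b)\<^sup>2)"
        using e by (intro sum.cong) (auto simp: B_def inner_Basis)
      then show ?thesis using B(1,2) e by (simp add: inner_Basis)
    qed
    finally have "(norm (?y - (?y \<bullet> e) *\<^sub>R e))\<^sup>2 = (\<Sum>b\<in>B. (f b)\<^sup>2)" .
    from real_sqrt_unique[OF this norm_ge_zero]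
    show ?thesis unfolding solid_cone_def S_def mem_Collect_eq i[OF e] by simp
  qed
  have coord: "(\<lambda>f. f b) \<in> borel_measurable P" if "b \<in> insert e B" for b
    unfolding P_def using measurable_component_singleton[OF that, of "\<lambda>_. lborel :: real measure"] by simp
  have [measurable]: "(\<lambda>f. f e) \<in> borel_measurable P" "(\<lambda>f. \<Sum>b\<in>B. (f b)\<^sup>2) \<in> borel_measurable P"
    using coord by (auto intro!: borel_measurable_sum borel_measurable_power)
  have "{f \<in> space P. sqrt (\<Sum>b\<in>B. (f b)\<^sup>2) \<le> \<tau> * f e} \<in> sets P"
    using \<open>(\<lambda>f. \<Sum>b\<in>B. (f b)\<^sup>2) \<in> borel_measurable P\<close>
    by (intro borel_measurable_le borel_measurable_times borel_measurable_sqrt) auto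
  moreover have "{f \<in> space P. 0 < f e \<and> f e \<le> a} \<in> sets P"
    by measurable
  moreover have "S \<inter> space P = {f \<in> space P. sqrt (\<Sum>b\<in>B. (f b)\<^sup>2) \<le> \<tau> * f e} \<inter>
      {f \<in> space P. 0 < f e \<and> f e \<le> a}"
    by (auto simp: S_def)
  ultimately have [measurable]: "S \<inter> space P \<in> sets P"
    by simp
  have slice [measurable]: "{f. sqrt (\<Sum>b\<in>B. (f b)\<^sup>2) \<le> c} \<inter> space (Pi\<^sub>M B (\<lambda>_. lborel)) \<in> sets (Pi\<^sub>M B (\<lambda>_. lborel))"
    for c :: real
  proof -
    have "(\<lambda>f. f b) \<in> borel_measurable (Pi\<^sub>M B (\<lambda>_. lborel :: real measure))" if "b \<in> B" for b
      using measurable_component_singleton[OF that, of "\<lambda>_. lborel :: real measure"] by simp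
    then have "(\<lambda>f. sqrt (\<Sum>b\<in>B. (f b)\<^sup>2)) \<in> borel_measurable (Pi\<^sub>M B (\<lambda>_. lborel :: real measure))"
      by (intro measurable_compose[OF _ borel_measurable_sqrt] borel_measurable_sum borel_measurable_power)
    from borel_measurable_le[OF this borel_measurable_const[of c]]
    show ?thesis by (simp add: Int_def conj_commute)
  qed
  have "emeasure lborel (solid_cone e a \<tau>) =
        emeasure (distr (Pi\<^sub>M Basis (\<lambda>_. lborel)) borel (\<lambda>f. \<Sum>b\<in>Basis. f b *\<^sub>R b)) (solid_cone e a \<tau>)"
    by (simp flip: lborel_eq)
  also have "\<dots> = emeasure (Pi\<^sub>M Basis (\<lambda>_. lborel)) ((\<lambda>f. \<Sum>b\<in>Basis. f b *\<^sub>R b) -` solid_cone e a \<tau>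
      \<inter> space (Pi\<^sub>M Basis (\<lambda>_. lborel)))"
  proof (rule emeasure_distr)
    have "(\<lambda>f. \<Sum>b\<in>Basis. f b *\<^sub>R b) \<in> borel_measurable P"
      using B(3) by (intro borel_measurable_sum borel_measurable_scaleR borel_measurable_const coord) simp
    then show "(\<lambda>f. \<Sum>b\<in>Basis. f b *\<^sub>R b :: 'a) \<in> borel_measurable (Pi\<^sub>M Basis (\<lambda>_. lborel))"
      by (simp add: P_def B(3))
  qed simp
  also have "\<dots> = emeasure P (S \<inter> space P)"
    unfolding P_def B(3)[symmetric] using in_cone by (intro arg_cong2[where f=emeasure]) auto
  also have "\<dots> = (\<integral>\<^sup>+f. indicator (S \<inter> space P) f \<partial>P)"
    by simp
  also have "\<dots> = (\<integral>\<^sup>+ y. \<integral>\<^sup>+ x. indicator (S \<inter> space P) (x(e := y)) \<partial>Pi\<^sub>M B (\<lambda>_. lborel) \<partial>lborel)"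
    unfolding P_def using B(1,2)
    by (subst product_nn_integral_insert_rev) (auto simp: P_def[symmetric])
  also have "\<dots> = (\<integral>\<^sup>+ y. \<integral>\<^sup>+ x. indicator {0<..a} y * indicator ({f. sqrt (\<Sum>b\<in>B. (f b)\<^sup>2) \<le> \<tau> * y}
       \<inter> space (Pi\<^sub>M B (\<lambda>_. lborel))) x \<partial>Pi\<^sub>M B (\<lambda>_. lborel) \<partial>lborel)"
  proof (intro nn_integral_cong, goal_cases)
    case (1 y f)
    have "(\<Sum>b\<in>B. ((f(e := y)) b)\<^sup>2) = (\<Sum>b\<in>B. (f b)\<^sup>2)"
      using B(2) by (intro sum.cong) auto
    then show ?case using 1
      by (auto simp: indicator_def S_def P_def space_PiM PiE_def)
  qed
  also have "\<dots> = (\<integral>\<^sup>+ y. indicator {0<..a} y * (\<integral>\<^sup>+ x. indicator ({f. sqrt (\<Sum>b\<in>B. (f b)\<^sup>2) \<le> \<tau> * y}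
       \<inter> space (Pi\<^sub>M B (\<lambda>_. lborel))) x \<partial>Pi\<^sub>M B (\<lambda>_. lborel)) \<partial>lborel)"
    using slice by (subst nn_integral_cmult) auto
  also have "\<dots> = (\<integral>\<^sup>+ y. indicator {0<..a} y * emeasure (Pi\<^sub>M B (\<lambda>_. lborel)) ({f. sqrt (\<Sum>b\<in>B. (f b)\<^sup>2) \<le> \<tau> * y}
       \<inter> space (Pi\<^sub>M B (\<lambda>_. lborel))) \<partial>lborel)"
    using slice by (intro nn_integral_cong, subst nn_integral_indicator) auto
  also have "\<dots> = (\<integral>\<^sup>+ y. ennreal (unit_ball_vol (card B) * \<tau> ^ card B) *
      ennreal (indicator {0..a} y * y ^ (DIM('a) - 1)) \<partial>lborel)"
  \<comment> \<open>The point \<open>y = 0\<close> is left out: in dimension 1 the power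
    \<open>y ^ 0\<close> is 1 there, and the integrands differ.\<close>
  proof (intro nn_integral_cong_AE AE_I[of _ _ "{0}"], goal_cases)
    case 1
    have "(indicator {0<..a} y * emeasure (Pi\<^sub>M B (\<lambda>_. lborel)) ({f. sqrt (\<Sum>b\<in>B. (f b)\<^sup>2) \<le> \<tau> * y}
       \<inter> space (Pi\<^sub>M B (\<lambda>_. lborel)))) = ennreal (unit_ball_vol (card B) * \<tau> ^ card B) *
      ennreal (indicator {0..a} y * y ^ (DIM('a) - 1))" if "y \<noteq> 0" for y :: real
    proof (cases "y > 0")
      case True
      then show ?thesis
        using emeasure_cball_aux[OF B(1), of "\<tau> * y"] pos B(4)
        by (simp add: indicator_def power_mult_distrib ennreal_mult'[symmetric] mult_ac)
    qed (use that in \<open>auto simp: indicator_def\<close>)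
    then show ?case by (intro subsetI) force
  qed auto
  also have "\<dots> = ennreal (unit_ball_vol (card B) * \<tau> ^ card B) * ennreal (a ^ DIM('a) / DIM('a))"
    using pos nn_integral_power_Icc[of a "DIM('a)"] by (subst nn_integral_cmult) simp_all
  also have "\<dots> = ennreal (unit_ball_vol (DIM('a) - 1) * \<tau> ^ (DIM('a) - 1) * a ^ DIM('a) / DIM('a))"
    using pos B(4) by (simp add: ennreal_mult'[symmetric])
  finally show ?thesis .
qed

text \<open>A rotation carries a coordinate axis to \<open>q\<close> and preserves volume; the
  coordinate \<open>i\<close> is arbitrary.\<close>

lemma emeasure_solid_cone:
  fixes q :: "real^'d::finite"
  assumes q: "norm q = 1" and pos: "a > 0" "\<tau> > 0"
  shows "emeasure lborel (solid_cone q a \<tau>) =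
    ennreal (unit_ball_vol (CARD('d) - 1) * \<tau> ^ (CARD('d) - 1) * a ^ CARD('d) / CARD('d))"
proof -
  fix i :: 'd
  define e :: "real^'d" where "e = axis i 1"
  have e: "e \<in> Basis" "norm e = 1" by (auto simp: e_def)
  obtain f where f: "orthogonal_transformation f" "f e = q"
    using orthogonal_transformation_exists_1[OF e(2) q] by blast
  have lin: "linear f" using f by (simp add: orthogonal_transformation_linear)
  have contf: "continuous_on UNIV f"
    using lin by (simp add: linear_continuous_on linear_linear)
  have [measurable]: "f \<in> borel_measurable borel"
    by (rule borel_measurable_continuous_onI[OF contf])
  have "f -` solid_cone q a \<tau> = solid_cone e a \<tau>"
  proof -
    have 1: "f y \<bullet> q = y \<bullet> e" for y
      using f unfolding orthogonal_transformation_def by metis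
    have "f y - (y \<bullet> e) *\<^sub>R q = f (y - (y \<bullet> e) *\<^sub>R e)" for y
      using f(2) lin by (simp add: linear_diff linear_scale)
    then show ?thesis
      using orthogonal_transformation_norm[OF f(1)] by (auto simp: solid_cone_def 1)
  qed
  moreover have "emeasure lborel (solid_cone q a \<tau>) = emeasure (distr lborel borel f) (solid_cone q a \<tau>)"
    by (simp add: lborel_distr_orthogonal_transformation[OF f(1)])
  ultimately show ?thesis
    using emeasure_solid_cone_Basis[OF e(1) pos] by (simp add: emeasure_distr)
qed

section \<open>Surface measure of small caps\<close>

definition sphere_cap :: "'a::real_inner \<Rightarrow> real \<Rightarrow> 'a set" where
  "sphere_cap q t = {x. norm x = 1 \<and> 1 - q \<bullet> x \<le> t}"

lemma sphere_cap_borel [measurable]: "sphere_cap (q::'a::euclidean_space) t \<in> sets borel"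
  unfolding sphere_cap_def by measurable

lemma sets_sphere_measure [simp, measurable_cong]: "sets sphere_measure = sets borel"
  by (simp add: sphere_measure_def)

lemma space_sphere_measure [simp]: "space sphere_measure = UNIV"
  by (simp add: sphere_measure_def)

lemma emeasure_sphere_measure:
  fixes S :: "(real^'d::finite) set"
  assumes [measurable]: "S \<in> sets borel"
  shows "emeasure sphere_measure S =
    ennreal (real CARD('d)) * emeasure lborel {y \<in> cball 0 1 - {0}. y /\<^sub>R norm y \<in> S}"
proof -
  let ?B = "cball 0 1 - {0 :: real^'d}"
  let ?r = "\<lambda>y :: real^'d. y /\<^sub>R norm y"
  have rm: "?r \<in> restrict_space lborel ?B \<rightarrow>\<^sub>M borel"
    by (rule measurable_restrict_space1) measurable
  have "emeasure sphere_measure S = (\<integral>\<^sup>+x. ennreal (real CARD('d)) * indicator S x \<partial>distr (restrict_space lborel ?B) borel ?r)"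
    unfolding sphere_measure_def by (subst emeasure_density) auto
  also have "\<dots> = ennreal (real CARD('d)) * emeasure (distr (restrict_space lborel ?B) borel ?r) S"
    by (rule nn_integral_cmult_indicator) simp
  also have "emeasure (distr (restrict_space lborel ?B) borel ?r) S =
      emeasure (restrict_space lborel ?B) (?r -` S \<inter> space (restrict_space lborel ?B))"
    by (rule emeasure_distr[OF rm]) simp
  also have "\<dots> = emeasure lborel (?r -` S \<inter> space (restrict_space lborel ?B))"
    by (rule emeasure_restrict_space) (auto simp: space_restrict_space)
  also have "?r -` S \<inter> space (restrict_space lborel ?B) = {y \<in> ?B. y /\<^sub>R norm y \<in> S}"
    by (auto simp: space_restrict_space)
  finally show ?thesis .
qed

lemma norm_minus_proj:
  fixes q y :: "'a::real_inner"
  assumes "norm q = 1"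
  shows "(norm (y - (y \<bullet> q) *\<^sub>R q))\<^sup>2 = (norm y)\<^sup>2 - (y \<bullet> q)\<^sup>2"
proof -
  have "q \<bullet> q = 1" using assms by (simp add: norm_eq_1)
  then show ?thesis
    unfolding power2_norm_eq_inner
    by (simp add: inner_diff_left inner_diff_right inner_commute power2_eq_square)
qed

text \<open>With c = 1 - t the sector over the cap consists of the nonzero y with norm y <= 1 and c
  norm y <= <y, q>, and \<open>\<tau>\<close> is the tangent of its opening angle arccos c. A cone
  point at height h <= c has norm at most h / c <= 1; conversely, heights in the sector are at most
  1 by Cauchy-Schwarz.\<close>

lemma solid_cone_cap_bounds:
  fixes q :: "'a::real_inner"
  assumes q: "norm q = 1" and t: "0 < t" "t < 1"
  defines "\<tau> \<equiv> sqrt (1 / (1 - t)\<^sup>2 - 1)"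
  shows "solid_cone q (1 - t) \<tau> \<subseteq> {y \<in> cball 0 1 - {0}. y /\<^sub>R norm y \<in> sphere_cap q t}" (is "_ \<subseteq> ?D")
    and "{y \<in> cball 0 1 - {0}. y /\<^sub>R norm y \<in> sphere_cap q t} \<subseteq> solid_cone q 1 \<tau>"
    and "0 < \<tau>"
proof -
  define c where "c = 1 - t"
  have c: "0 < c" "c < 1" using t by (auto simp: c_def)
  have "c\<^sup>2 < 1" using c by (simp add: power_less_one_iff abs_square_less_1)
  then have "1 < 1 / c\<^sup>2" using c by simp
  then show tau: "0 < \<tau>" by (simp add: \<tau>_def c_def)
  have tau2: "\<tau>\<^sup>2 = 1 / c\<^sup>2 - 1" using \<open>1 < 1 / c\<^sup>2\<close> by (simp add: \<tau>_def c_def)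
  \<comment> \<open>With Pythagoras, this makes the slope condition at height \<open>h\<close>
    equivalent to \<open>norm y <= h / c\<close>.\<close>
  have sq: "(\<tau> * h)\<^sup>2 = (h / c)\<^sup>2 - h\<^sup>2" for h
    unfolding power_mult_distrib tau2 power_divide by (simp add: left_diff_distrib)
  have mem: "y \<in> ?D \<longleftrightarrow> y \<noteq> 0 \<and> norm y \<le> 1 \<and> c * norm y \<le> y \<bullet> q" for y
  proof (cases "y = 0")
    case False
    have "1 - q \<bullet> (y /\<^sub>R norm y) \<le> t \<longleftrightarrow> c \<le> (y \<bullet> q) / norm y"
      by (auto simp: c_def inner_commute divide_inverse mult.commute)
    also have "\<dots> \<longleftrightarrow> c * norm y \<le> y \<bullet> q" using False by (simp add: field_simps)
    finally show ?thesis using False by (auto simp: sphere_cap_def)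
  qed simp
  show "solid_cone q (1 - t) \<tau> \<subseteq> ?D"
  proof
    fix y assume "y \<in> solid_cone q (1 - t) \<tau>"
    then have y: "0 < y \<bullet> q" "y \<bullet> q \<le> c" "norm (y - (y \<bullet> q) *\<^sub>R q) \<le> \<tau> * (y \<bullet> q)"
      by (auto simp: solid_cone_def c_def)
    have "(norm y)\<^sup>2 - (y \<bullet> q)\<^sup>2 \<le> (\<tau> * (y \<bullet> q))\<^sup>2"
      unfolding norm_minus_proj[OF q, symmetric] using y(3) by (intro power_mono) auto
    then have "(norm y)\<^sup>2 \<le> ((y \<bullet> q) / c)\<^sup>2"
      unfolding sq by simp
    then have le: "norm y \<le> (y \<bullet> q) / c"
      by (rule power2_le_imp_le) (use y(1) c in simp)
    moreover have "(y \<bullet> q) / c \<le> 1" using y c by simp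
    moreover have "c * norm y \<le> y \<bullet> q" using le c by (simp add: field_simps)
    ultimately show "y \<in> ?D" unfolding mem using y(1) by auto
  qed
  show "?D \<subseteq> solid_cone q 1 \<tau>"
  proof
    fix y assume "y \<in> ?D"
    then have y: "y \<noteq> 0" "norm y \<le> 1" "c * norm y \<le> y \<bullet> q" unfolding mem by auto
    have pos: "0 < y \<bullet> q" using y c by (meson less_le_trans mult_pos_pos zero_less_norm_iff)
    have le1: "y \<bullet> q \<le> 1" using norm_cauchy_schwarz[of y q] q y(2) by simp
    have "(norm y)\<^sup>2 \<le> ((y \<bullet> q) / c)\<^sup>2"
      using y(3) c by (intro power_mono) (simp_all add: field_simps)
    then have "(norm (y - (y \<bullet> q) *\<^sub>R q))\<^sup>2 \<le> (\<tau> * (y \<bullet> q))\<^sup>2"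
      unfolding norm_minus_proj[OF q] sq by simp
    then have "norm (y - (y \<bullet> q) *\<^sub>R q) \<le> \<tau> * (y \<bullet> q)"
      by (rule power2_le_imp_le) (use tau pos in simp)
    then show "y \<in> solid_cone q 1 \<tau>" using pos le1 by (simp add: solid_cone_def)
  qed
qed

text \<open>The factor d in \<open>sphere_measure\<close> cancels the 1 / d of the cone volume. The
  power of t comes from \<tau>^2 = t (2 - t) / (1 - t)^2 and d - 1 = 2 s.\<close>

lemma measure_sphere_cap_bounds:
  fixes q :: "real^'d::finite"
  assumes q: "norm q = 1" and t: "0 < t" "t < 1"
  defines "V \<equiv> unit_ball_vol (CARD('d) - 1)" and "s \<equiv> (real CARD('d) - 1) / 2"
  shows "V * (1 - t) ^ CARD('d) * ((2 - t) / (1 - t)\<^sup>2) powr s * t powr s \<le> measure sphere_measure (sphere_cap q t)"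
    and "measure sphere_measure (sphere_cap q t) \<le> V * ((2 - t) / (1 - t)\<^sup>2) powr s * t powr s"
    and "emeasure sphere_measure (sphere_cap q t) < \<infinity>"
proof -
  define \<tau> where "\<tau> = sqrt (1 / (1 - t)\<^sup>2 - 1)"
  note b = solid_cone_cap_bounds[OF q t, folded \<tau>_def]
  have d: "0 < CARD('d)" by simp
  have tp: "\<tau> ^ (CARD('d) - 1) = ((2 - t) / (1 - t)\<^sup>2) powr s * t powr s"
  proof -
    have "1 < 1 / (1 - t)\<^sup>2" using b(3) by (simp add: \<tau>_def)
    then have "\<tau>\<^sup>2 = 1 / (1 - t)\<^sup>2 - 1" by (simp add: \<tau>_def)
    also have "\<dots> = (2 - t) / (1 - t)\<^sup>2 * t"
      using t by (simp add: field_simps) (simp add: power2_eq_square algebra_simps)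
    finally have t2: "\<tau>\<^sup>2 = (2 - t) / (1 - t)\<^sup>2 * t" .
    have "\<tau> ^ (CARD('d) - 1) = \<tau> powr (real (CARD('d) - 1))"
      by (rule powr_realpow[OF b(3), symmetric])
    also have "\<dots> = (\<tau>\<^sup>2) powr s"
    proof -
      have "real (CARD('d) - 1) = 2 * s" using d by (simp add: s_def of_nat_diff)
      moreover have "\<tau>\<^sup>2 = \<tau> powr 2" using b(3) by simp
      ultimately show ?thesis by (simp only: powr_powr)
    qed
    also have "\<dots> = ((2 - t) / (1 - t)\<^sup>2) powr s * t powr s"
      unfolding t2 by (rule powr_mult)
    finally show ?thesis .
  qed
  define D where "D = {y \<in> cball 0 1 - {0}. y /\<^sub>R norm y \<in> sphere_cap q t}"
  have Dm: "D \<in> sets lborel"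
  proof -
    have "D = {y. y \<noteq> 0 \<and> norm y \<le> 1 \<and> y /\<^sub>R norm y \<in> sphere_cap q t}" by (auto simp: D_def)
    then show ?thesis by simp
  qed
  have cap: "emeasure sphere_measure (sphere_cap q t) = ennreal (real CARD('d)) * emeasure lborel D"
    by (simp add: emeasure_sphere_measure D_def)
  have up: "emeasure lborel D \<le> ennreal (V * \<tau> ^ (CARD('d) - 1) / CARD('d))"
    using emeasure_mono[OF b(2), of lborel] emeasure_solid_cone[OF q _ b(3), of 1]
    by (simp add: D_def V_def)
  have lo: "ennreal (V * \<tau> ^ (CARD('d) - 1) * (1 - t) ^ CARD('d) / CARD('d)) \<le> emeasure lborel D"
    using emeasure_mono[OF b(1), of lborel] emeasure_solid_cone[OF q _ b(3), of "1 - t"] Dm t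
    by (simp add: D_def V_def)
  have up': "emeasure sphere_measure (sphere_cap q t) \<le> ennreal (V * \<tau> ^ (CARD('d) - 1))"
    using mult_left_mono[OF up, of "ennreal (real CARD('d))"] b(3) unfolding cap
    by (simp flip: ennreal_mult')
  have lo': "ennreal (V * \<tau> ^ (CARD('d) - 1) * (1 - t) ^ CARD('d)) \<le> emeasure sphere_measure (sphere_cap q t)"
    using mult_left_mono[OF lo, of "ennreal (real CARD('d))"] b(3) unfolding cap
    by (simp flip: ennreal_mult')
  show fin: "emeasure sphere_measure (sphere_cap q t) < \<infinity>"
    using up' by (simp add: less_top[symmetric] top_unique) (metis ennreal_neq_top top.extremum_unique)
  have V: "0 \<le> V" by (simp add: V_def)
  have em: "emeasure sphere_measure (sphere_cap q t) = ennreal (measure sphere_measure (sphere_cap q t))"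
    using fin by (intro emeasure_eq_ennreal_measure) auto
  show "measure sphere_measure (sphere_cap q t) \<le> V * ((2 - t) / (1 - t)\<^sup>2) powr s * t powr s"
    using up' V b(3) unfolding em tp[symmetric] mult.assoc by (subst (asm) ennreal_le_iff) auto
  show "V * (1 - t) ^ CARD('d) * ((2 - t) / (1 - t)\<^sup>2) powr s * t powr s \<le> measure sphere_measure (sphere_cap q t)"
    using lo' unfolding em tp by (subst (asm) ennreal_le_iff) (simp_all add: mult_ac)
qed

lemma measure_sphere_cap_asymp:
  fixes q :: "real^'d::finite"
  assumes q: "norm q = 1"
  defines "s \<equiv> (real CARD('d) - 1) / 2"
  shows "((\<lambda>t. measure sphere_measure (sphere_cap q t) / t powr s) \<longlongrightarrow> unit_ball_vol (CARD('d) - 1) * 2 powr s) (at_right 0)"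
proof (rule tendsto_sandwich)
  let ?V = "unit_ball_vol (CARD('d) - 1)"
  have ev: "\<forall>\<^sub>F t::real in at_right 0. 0 < t \<and> t < 1"
    using eventually_at_right_real[of 0 1] by (auto elim: eventually_mono)
  show "\<forall>\<^sub>F t in at_right 0. ?V * (1 - t) ^ CARD('d) * ((2 - t) / (1 - t)\<^sup>2) powr s \<le> measure sphere_measure (sphere_cap q t) / t powr s"
    using ev by eventually_elim (use measure_sphere_cap_bounds(1)[OF q] in \<open>simp add: s_def pos_le_divide_eq\<close>)
  show "\<forall>\<^sub>F t in at_right 0. measure sphere_measure (sphere_cap q t) / t powr s \<le> ?V * ((2 - t) / (1 - t)\<^sup>2) powr s"
    using ev by eventually_elim (use measure_sphere_cap_bounds(2)[OF q] in \<open>simp add: s_def pos_divide_le_eq\<close>)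
  have "((\<lambda>t. ?V * (1 - t) ^ CARD('d) * ((2 - t) / (1 - t)\<^sup>2) powr s) \<longlongrightarrow> ?V * (1 - 0) ^ CARD('d) * ((2 - 0) / (1 - 0)\<^sup>2) powr s) (at_right 0)"
    by (intro tendsto_intros) auto
  then show "((\<lambda>t. ?V * (1 - t) ^ CARD('d) * ((2 - t) / (1 - t)\<^sup>2) powr s) \<longlongrightarrow> ?V * 2 powr s) (at_right 0)"
    by simp
  have "((\<lambda>t. ?V * ((2 - t) / (1 - t)\<^sup>2) powr s) \<longlongrightarrow> ?V * ((2 - 0) / (1 - 0)\<^sup>2) powr s) (at_right 0)"
    by (intro tendsto_intros) auto
  then show "((\<lambda>t. ?V * ((2 - t) / (1 - t)\<^sup>2) powr s) \<longlongrightarrow> ?V * 2 powr s) (at_right 0)"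
    by simp
qed

text \<open>Gamma (z + 1) = z Gamma z at z = (n - 1) / 2. This converts the ball volume produced by
  the cones into the sphere area in which C(q) is expressed.\<close>

lemma unit_ball_vol_eq_sphere_area:
  assumes "2 \<le> n"
  shows "unit_ball_vol (real (n - 1)) = sphere_area (n - 2) / (real n - 1)"
proof -
  define z where "z = (real n - 1) / 2"
  have z: "z > 0" using assms by (simp add: z_def)
  have "unit_ball_vol (real (n - 1)) = pi powr z / Gamma (z + 1)"
    using assms by (simp add: unit_ball_vol_def z_def of_nat_diff)
  moreover have "sphere_area (n - 2) = 2 * pi powr z / Gamma z"
    using assms by (simp add: sphere_area_def z_def of_nat_diff)
  moreover have "Gamma (z + 1) = z * Gamma z"
    using z by (intro Gamma_plus1) (auto elim: nonpos_Ints_cases)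
  moreover have "real n - 1 = 2 * z" by (simp add: z_def)
  ultimately show ?thesis using z by simp
qed

text \<open>By continuity the mean of \<open>\<rho>\<close> over a shrinking cap tends to
  \<open>\<rho> q\<close>; it remains to multiply by the asymptotics of the cap itself.\<close>

lemma measure_density_sphere_cap_asymp:
  fixes q :: "real^'d::finite"
  assumes q: "norm q = 1"
    and rho: "\<rho> \<in> borel_measurable borel" "\<And>x. norm x = 1 \<Longrightarrow> 0 \<le> \<rho> x"
    and cont: "continuous (at q within sphere 0 1) \<rho>"
  defines "s \<equiv> (real CARD('d) - 1) / 2"
  shows "((\<lambda>t. measure (density sphere_measure (\<lambda>x. ennreal (\<rho> x))) (sphere_cap q t) / t powr s) \<longlongrightarrow>
    unit_ball_vol (CARD('d) - 1) * 2 powr s * \<rho> q) (at_right 0)"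
proof -
  note [measurable] = rho(1)
  define \<nu> where "\<nu> t = measure (density sphere_measure (\<lambda>x. ennreal (\<rho> x))) (sphere_cap q t)" for t
  define \<sigma> where "\<sigma> t = measure sphere_measure (sphere_cap q t)" for t
  have ev: "\<forall>\<^sub>F t::real in at_right 0. 0 < t \<and> t < 1"
    using eventually_at_right_real[of 0 1] by (auto elim: eventually_mono)
  have spos: "0 < \<sigma> t" if "0 < t \<and> t < 1" for t
  proof -
    have "0 < unit_ball_vol (CARD('d) - 1) * (1 - t) ^ CARD('d) * ((2 - t) / (1 - t)\<^sup>2) powr s * t powr s"
      using that by (intro mult_pos_pos) auto
    with measure_sphere_cap_bounds(1)[OF q, of t] that show ?thesis
      unfolding \<sigma>_def s_def by linarith
  qed
  have "((\<lambda>t. \<nu> t / \<sigma> t) \<longlongrightarrow> \<rho> q) (at_right 0)"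
  proof (rule tendstoI)
    fix e :: real assume "e > 0"
    then obtain d where d: "d > 0" and dd: "\<And>x. norm x = 1 \<Longrightarrow> dist x q < d \<Longrightarrow> dist (\<rho> x) (\<rho> q) < e / 2"
      using cont[unfolded continuous_within_eps_delta, rule_format, of "e/2"] by (auto simp: dist_norm)
    \<comment> \<open>On the sphere the squared distance from x to q is 2 (1 - <q, x>), so such a
      cap lies within distance \<open>d\<close> of \<open>q\<close>.\<close>
    have "\<forall>\<^sub>F t::real in at_right 0. t < d\<^sup>2 / 2"
      using eventually_at_right_real[of 0 "d\<^sup>2/2"] d by (auto elim: eventually_mono)
    with ev show "\<forall>\<^sub>F t in at_right 0. dist (\<nu> t / \<sigma> t) (\<rho> q) < e"
    proof eventually_elim
      case (elim t)
      have near: "\<bar>\<rho> x - \<rho> q\<bar> \<le> e / 2" if "x \<in> sphere_cap q t" for x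
      proof -
        have x: "norm x = 1" "1 - q \<bullet> x \<le> t" using that by (auto simp: sphere_cap_def)
        have "(dist x q)\<^sup>2 = 2 * (1 - q \<bullet> x)"
          using x(1) q unfolding dist_norm
          by (simp add: power2_norm_eq_inner inner_diff_left inner_diff_right inner_commute norm_eq_1)
        also have "\<dots> < d\<^sup>2" using x elim by simp
        finally have "dist x q < d" using d by (simp add: power2_less_imp_less)
        from dd[OF x(1) this] show ?thesis by (simp add: dist_real_def)
      qed
      have near': "\<rho> x \<le> \<rho> q + e / 2" "\<rho> q - e / 2 \<le> \<rho> x" if "x \<in> sphere_cap q t" for x
        using near[OF that] by linarith+
      have em: "emeasure sphere_measure (sphere_cap q t) = ennreal (\<sigma> t)"
        unfolding \<sigma>_def using measure_sphere_cap_bounds(3)[OF q, of t] elim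
        by (intro emeasure_eq_ennreal_measure) auto
      have nn: "emeasure (density sphere_measure (\<lambda>x. ennreal (\<rho> x))) (sphere_cap q t) =
          (\<integral>\<^sup>+x. ennreal (\<rho> x) * indicator (sphere_cap q t) x \<partial>sphere_measure)"
        by (rule emeasure_density) auto
      have up: "emeasure (density sphere_measure (\<lambda>x. ennreal (\<rho> x))) (sphere_cap q t) \<le> ennreal ((\<rho> q + e/2) * \<sigma> t)"
      proof -
        have "(\<integral>\<^sup>+x. ennreal (\<rho> x) * indicator (sphere_cap q t) x \<partial>sphere_measure) \<le>
          (\<integral>\<^sup>+x. ennreal (\<rho> q + e/2) * indicator (sphere_cap q t) x \<partial>sphere_measure)"
        proof (rule nn_integral_mono)
          fix x
          show "ennreal (\<rho> x) * indicator (sphere_cap q t) x \<le> ennreal (\<rho> q + e/2) * indicator (sphere_cap q t) x"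
            using near'[of x] by (auto simp: indicator_def intro!: ennreal_leI)
        qed
        also have "\<dots> = ennreal (\<rho> q + e/2) * ennreal (\<sigma> t)"
          by (subst nn_integral_cmult_indicator) (auto simp: em)
        also have "\<dots> = ennreal ((\<rho> q + e/2) * \<sigma> t)"
          using rho(2)[OF q] \<open>e > 0\<close> by (simp add: ennreal_mult')
        finally show ?thesis unfolding nn .
      qed
      have lo: "ennreal ((\<rho> q - e/2) * \<sigma> t) \<le> emeasure (density sphere_measure (\<lambda>x. ennreal (\<rho> x))) (sphere_cap q t)"
      proof -
        \<comment> \<open>The factor \<open>\<rho> q - e/2\<close> may be negative;
          \<open>ennreal\<close> then truncates both sides to 0.\<close>
        have "ennreal ((\<rho> q - e/2) * \<sigma> t) = ennreal (\<rho> q - e/2) * ennreal (\<sigma> t)"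
          using spos[OF elim(1)] by (simp add: ennreal_mult'' less_imp_le)
        also have "\<dots> = (\<integral>\<^sup>+x. ennreal (\<rho> q - e/2) * indicator (sphere_cap q t) x \<partial>sphere_measure)"
          by (subst nn_integral_cmult_indicator) (auto simp: em)
        also have "\<dots> \<le> (\<integral>\<^sup>+x. ennreal (\<rho> x) * indicator (sphere_cap q t) x \<partial>sphere_measure)"
        proof (rule nn_integral_mono)
          fix x
          show "ennreal (\<rho> q - e/2) * indicator (sphere_cap q t) x \<le> ennreal (\<rho> x) * indicator (sphere_cap q t) x"
            using near'[of x] by (auto simp: indicator_def intro!: ennreal_leI)
        qed
        finally show ?thesis unfolding nn .
      qed
      have nm: "emeasure (density sphere_measure (\<lambda>x. ennreal (\<rho> x))) (sphere_cap q t) = ennreal (\<nu> t)"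
        unfolding \<nu>_def using up by (intro emeasure_eq_ennreal_measure) (auto simp: top_unique)
      have sp: "0 < \<sigma> t" by (rule spos[OF elim(1)])
      have "\<nu> t \<le> (\<rho> q + e/2) * \<sigma> t"
        using up rho(2)[OF q] \<open>e > 0\<close> sp unfolding nm by (subst (asm) ennreal_le_iff) auto
      moreover have "(\<rho> q - e/2) * \<sigma> t \<le> \<nu> t"
        using lo unfolding nm by (subst (asm) ennreal_le_iff) (auto simp: \<nu>_def)
      ultimately have "\<nu> t / \<sigma> t \<le> \<rho> q + e/2" "\<rho> q - e/2 \<le> \<nu> t / \<sigma> t"
        using sp by (simp_all only: pos_divide_le_eq pos_le_divide_eq)
      then have "\<bar>\<nu> t / \<sigma> t - \<rho> q\<bar> \<le> e / 2"
        by linarith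
      then show ?case using \<open>e > 0\<close> by (simp add: dist_real_def)
    qed
  qed
  then have "((\<lambda>t. (\<nu> t / \<sigma> t) * (\<sigma> t / t powr s)) \<longlongrightarrow> \<rho> q * (unit_ball_vol (CARD('d) - 1) * 2 powr s)) (at_right 0)"
    unfolding \<sigma>_def s_def by (rule tendsto_mult[OF _ measure_sphere_cap_asymp[OF q]])
  moreover have "\<forall>\<^sub>F t in at_right 0. (\<nu> t / \<sigma> t) * (\<sigma> t / t powr s) = \<nu> t / t powr s"
    using ev by eventually_elim (use spos in force)
  ultimately have "((\<lambda>t. \<nu> t / t powr s) \<longlongrightarrow> \<rho> q * (unit_ball_vol (CARD('d) - 1) * 2 powr s)) (at_right 0)"
    by (rule Lim_transform_eventually)
  then show ?thesis by (simp add: \<nu>_def mult_ac)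
qed

section \<open>Limits in probability\<close>

text \<open>Pairs \<open>(n, \<omega>)\<close> are filtered by "with probability tending to one as \<open>n\<close> grows", so that
  limits in probability become limits along a filter and inherit the limit calculus.\<close>

definition whp :: "'a measure \<Rightarrow> (nat \<times> 'a) filter" where
  "whp M = Abs_filter (\<lambda>P. \<exists>B. (\<forall>n. B n \<in> sets M) \<and> (\<lambda>n. measure M (B n)) \<longlonglongrightarrow> 0 \<and>
     (\<forall>n. \<forall>\<omega>\<in>space M - B n. P (n, \<omega>)))"

context finite_measure
begin

text \<open>The filter axiom for conjunctions is the union bound. Measurability is asked of the
  exceptional sets \<open>B n\<close> only, so \<open>P\<close> may be an arbitrary
  predicate.\<close>

lemma eventually_whp:
  "eventually P (whp M) \<longleftrightarrow> (\<exists>B. (\<forall>n. B n \<in> sets M) \<and> (\<lambda>n. measure M (B n)) \<longlonglongrightarrow> 0 \<and>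
     (\<forall>n. \<forall>\<omega>\<in>space M - B n. P (n, \<omega>)))"
  unfolding whp_def
proof (rule eventually_Abs_filter, rule is_filter.intro, goal_cases)
  case 1
  show ?case by (intro exI[of _ "\<lambda>_. {}"]) auto
next
  case (2 P Q)
  then obtain B C where B: "\<And>n. B n \<in> sets M" "(\<lambda>n. measure M (B n)) \<longlonglongrightarrow> 0" "\<And>n \<omega>. \<omega> \<in> space M - B n \<Longrightarrow> P (n, \<omega>)"
    and C: "\<And>n. C n \<in> sets M" "(\<lambda>n. measure M (C n)) \<longlonglongrightarrow> 0" "\<And>n \<omega>. \<omega> \<in> space M - C n \<Longrightarrow> Q (n, \<omega>)"
    by metis
  have "(\<lambda>n. measure M (B n \<union> C n)) \<longlonglongrightarrow> 0"
  proof (rule tendsto_sandwich[OF _ _ tendsto_const])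
    show "(\<lambda>n. measure M (B n) + measure M (C n)) \<longlonglongrightarrow> 0"
      using tendsto_add[OF B(2) C(2)] by simp
    show "\<forall>\<^sub>F n in sequentially. measure M (B n \<union> C n) \<le> measure M (B n) + measure M (C n)"
      using B(1) C(1) by (intro always_eventually allI measure_Un_le)
  qed simp
  then show ?case using B C by (intro exI[of _ "\<lambda>n. B n \<union> C n"]) auto
next
  case (3 P Q)
  then show ?case by blast
qed

text \<open>Finitely many sample sizes may be discarded: for these the whole space serves as
  exceptional set.\<close>

lemma eventually_whp_sequentially:
  assumes "\<forall>\<^sub>F n in sequentially. \<forall>\<omega>\<in>space M. P (n, \<omega>)"
  shows "eventually P (whp M)"
proof -
  define B where "B n = (if \<forall>\<omega>\<in>space M. P (n, \<omega>) then {} else space M)" for n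
  have "\<forall>\<^sub>F n in sequentially. measure M (B n) = 0"
    using assms by eventually_elim (auto simp: B_def)
  then have "(\<lambda>n. measure M (B n)) \<longlonglongrightarrow> 0" by (rule tendsto_eventually)
  then show ?thesis
    unfolding eventually_whp by (intro exI[of _ B]) (auto simp: B_def split: if_splits)
qed

lemma filterlim_fst_whp: "filterlim fst sequentially (whp M)"
  unfolding filterlim_iff
proof (intro allI impI)
  fix P :: "nat \<Rightarrow> bool" assume "eventually P sequentially"
  then show "\<forall>\<^sub>F x in whp M. P (fst x)"
    by (intro eventually_whp_sequentially) (auto elim: eventually_mono)
qed

lemma conv_in_prob_whp:
  assumes "((\<lambda>p. Y (fst p) (snd p)) \<longlongrightarrow> c) (whp M)"
  shows "conv_in_prob M Y c"
  unfolding conv_in_prob_def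
proof (intro allI impI)
  fix e :: real assume "e > 0"
  with assms have "\<forall>\<^sub>F p in whp M. dist (Y (fst p) (snd p)) c < e" by (rule tendstoD)
  then obtain B where B: "\<And>n. B n \<in> sets M" "(\<lambda>n. measure M (B n)) \<longlonglongrightarrow> 0"
    "\<And>n \<omega>. \<omega> \<in> space M - B n \<Longrightarrow> dist (Y n \<omega>) c < e"
    unfolding eventually_whp by auto
  show "(\<lambda>n. measure M {\<omega> \<in> space M. e < \<bar>Y n \<omega> - c\<bar>}) \<longlonglongrightarrow> 0"
  proof (rule tendsto_sandwich[OF _ _ tendsto_const B(2)])
    show "\<forall>\<^sub>F n in sequentially. measure M {\<omega> \<in> space M. e < \<bar>Y n \<omega> - c\<bar>} \<le> measure M (B n)"
    proof (intro always_eventually allI)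
      fix n
      have "{\<omega> \<in> space M. e < \<bar>Y n \<omega> - c\<bar>} \<subseteq> B n"
        using B(3)[of _ n] by (force simp: dist_real_def)
      then show "measure M {\<omega> \<in> space M. e < \<bar>Y n \<omega> - c\<bar>} \<le> measure M (B n)"
        using B(1) by (rule finite_measure_mono)
    qed
  qed simp
qed

end

section \<open>A weak law of large numbers for triangular arrays\<close>

lemma (in prob_space) expectation_sum_power2_indep:
  fixes Z :: "'i \<Rightarrow> 'a \<Rightarrow> real"
  assumes I: "finite I" and ind: "indep_vars (\<lambda>_. borel) Z I"
    and int: "\<And>i. i \<in> I \<Longrightarrow> integrable M (Z i)" "\<And>i. i \<in> I \<Longrightarrow> integrable M (\<lambda>\<omega>. (Z i \<omega>)\<^sup>2)"
    and mean: "\<And>i. i \<in> I \<Longrightarrow> expectation (Z i) = 0"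
  shows "integrable M (\<lambda>\<omega>. (\<Sum>i\<in>I. Z i \<omega>)\<^sup>2)"
    and "expectation (\<lambda>\<omega>. (\<Sum>i\<in>I. Z i \<omega>)\<^sup>2) = (\<Sum>i\<in>I. expectation (\<lambda>\<omega>. (Z i \<omega>)\<^sup>2))"
proof -
  have prod: "integrable M (\<lambda>\<omega>. Z i \<omega> * Z j \<omega>)" "expectation (\<lambda>\<omega>. Z i \<omega> * Z j \<omega>) = 0"
    if ij: "i \<in> I" "j \<in> I" "i \<noteq> j" for i j
  proof -
    have ind2: "indep_vars (\<lambda>_. borel) Z {i, j}" using ind ij by (rule_tac indep_vars_subset) auto
    have int2: "integrable M (Z k)" if "k \<in> {i, j}" for k using that ij int(1) by auto
    show "integrable M (\<lambda>\<omega>. Z i \<omega> * Z j \<omega>)"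
      using indep_vars_integrable[OF _ ind2 int2] ij by simp
    show "expectation (\<lambda>\<omega>. Z i \<omega> * Z j \<omega>) = 0"
      using indep_vars_lebesgue_integral[OF _ ind2 int2] ij mean by simp
  qed
  have int3: "integrable M (\<lambda>\<omega>. Z i \<omega> * Z j \<omega>)" if "i \<in> I" "j \<in> I" for i j
    using that prod(1) int(2) by (cases "i = j") (auto simp: power2_eq_square)
  have eq: "(\<Sum>i\<in>I. Z i \<omega>)\<^sup>2 = (\<Sum>i\<in>I. \<Sum>j\<in>I. Z i \<omega> * Z j \<omega>)" for \<omega>
    by (simp add: power2_eq_square sum_product)
  show "integrable M (\<lambda>\<omega>. (\<Sum>i\<in>I. Z i \<omega>)\<^sup>2)"
    unfolding eq by (intro Bochner_Integration.integrable_sum int3)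
  have "expectation (\<lambda>\<omega>. (\<Sum>i\<in>I. Z i \<omega>)\<^sup>2) = (\<Sum>i\<in>I. \<Sum>j\<in>I. expectation (\<lambda>\<omega>. Z i \<omega> * Z j \<omega>))"
    unfolding eq by (simp add: int3)
  also have "\<dots> = (\<Sum>i\<in>I. \<Sum>j\<in>I. if i = j then expectation (\<lambda>\<omega>. (Z i \<omega>)\<^sup>2) else 0)"
    using prod(2) by (intro sum.cong) (auto simp: power2_eq_square)
  also have "\<dots> = (\<Sum>i\<in>I. expectation (\<lambda>\<omega>. (Z i \<omega>)\<^sup>2))"
    using I by simp
  finally show "expectation (\<lambda>\<omega>. (\<Sum>i\<in>I. Z i \<omega>)\<^sup>2) = (\<Sum>i\<in>I. expectation (\<lambda>\<omega>. (Z i \<omega>)\<^sup>2))" .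
qed

text \<open>The numerator is the mean \<open>\<mu>\<close>, not the number of summands. This keeps
  the bound small for deviations of the order of \<open>\<mu>\<close> even when the mean of a single
  summand tends to 0.\<close>

lemma (in prob_space) iid_sum_deviation:
  fixes T :: "nat \<Rightarrow> 'a \<Rightarrow> real" and g :: "real \<Rightarrow> real"
  assumes ind: "indep_vars (\<lambda>_. borel) T UNIV"
    and law: "\<And>i. distr M borel (T i) = D"
    and g: "g \<in> borel_measurable borel" "\<And>x. 0 \<le> g x" "\<And>x. g x \<le> 1"
    and I: "finite I" and a: "0 < a"
  defines "\<mu> \<equiv> real (card I) * integral\<^sup>L D g"
  shows "prob {\<omega> \<in> space M. a \<le> \<bar>(\<Sum>j\<in>I. g (T j \<omega>)) - \<mu>\<bar>} \<le> \<mu> / a\<^sup>2"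
proof -
  have T [measurable]: "T i \<in> borel_measurable M" for i
    using ind by (simp add: indep_vars_def)
  note g(1) [measurable]
  define m where "m = integral\<^sup>L D g"
  have mean: "expectation (\<lambda>\<omega>. g (T i \<omega>)) = m" for i
    unfolding m_def law[of i, symmetric] by (rule integral_distr[symmetric]) auto
  have bnd: "integrable M (\<lambda>\<omega>. h (g (T i \<omega>)))" if "h \<in> borel_measurable borel" "\<And>x. 0 \<le> x \<Longrightarrow> x \<le> 1 \<Longrightarrow> \<bar>h x\<bar> \<le> 1"
    for h :: "real \<Rightarrow> real" and i
    using that g by (intro integrable_const_bound[of _ 1]) auto
  have int1: "integrable M (\<lambda>\<omega>. g (T i \<omega>))" for i using bnd[of "\<lambda>x. x" i] by simp
  have int2: "integrable M (\<lambda>\<omega>. (g (T i \<omega>))\<^sup>2)" for i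
    using bnd[of "\<lambda>x. x\<^sup>2" i] by (simp add: abs_square_le_1)
  define Z where "Z i \<omega> = g (T i \<omega>) - m" for i \<omega>
  have Z2: "(Z i \<omega>)\<^sup>2 = (g (T i \<omega>))\<^sup>2 - 2 * m * g (T i \<omega>) + m\<^sup>2" for i \<omega>
    by (simp add: Z_def power2_eq_square algebra_simps)
  have intZ: "integrable M (Z i)" "integrable M (\<lambda>\<omega>. (Z i \<omega>)\<^sup>2)" for i
    using int1 int2 unfolding Z2 by (auto simp: Z_def[abs_def])
  have meanZ: "expectation (Z i) = 0" for i
    using int1 mean by (simp add: Z_def[abs_def] prob_space)
  have indZ: "indep_vars (\<lambda>_. borel) Z I"
  proof -
    have "indep_vars (\<lambda>_. borel) (\<lambda>i. (\<lambda>x. g x - m) \<circ> T i) I"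
      using indep_vars_subset[OF ind, of I] by (intro indep_vars_compose[where M'="\<lambda>_. borel"]) auto
    then show ?thesis by (simp add: Z_def[abs_def] comp_def)
  qed
  have varZ: "expectation (\<lambda>\<omega>. (Z i \<omega>)\<^sup>2) \<le> m" for i
  proof -
    have "expectation (\<lambda>\<omega>. (Z i \<omega>)\<^sup>2) = expectation (\<lambda>\<omega>. (g (T i \<omega>))\<^sup>2) - m\<^sup>2"
      unfolding Z2 using int1[of i] int2[of i] by (simp add: mean prob_space power2_eq_square)
    also have "\<dots> \<le> expectation (\<lambda>\<omega>. (g (T i \<omega>))\<^sup>2)" by simp
    also have "\<dots> \<le> expectation (\<lambda>\<omega>. g (T i \<omega>))"
      using g by (intro integral_mono int1 int2) (simp add: power2_eq_square mult_left_le)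
    finally show ?thesis by (simp add: mean)
  qed
  have sumZ: "(\<Sum>j\<in>I. g (T j \<omega>)) - \<mu> = (\<Sum>j\<in>I. Z j \<omega>)" for \<omega>
    by (simp add: Z_def sum_subtractf \<mu>_def m_def)
  have e: "expectation (\<lambda>\<omega>. \<Sum>j\<in>I. Z j \<omega>) = 0"
    using intZ meanZ by simp
  have "prob {\<omega> \<in> space M. a \<le> \<bar>(\<Sum>j\<in>I. Z j \<omega>) - expectation (\<lambda>\<omega>. \<Sum>j\<in>I. Z j \<omega>)\<bar>} \<le>
      variance (\<lambda>\<omega>. \<Sum>j\<in>I. Z j \<omega>) / a\<^sup>2"
    using expectation_sum_power2_indep(1)[OF I indZ intZ meanZ] a
    by (intro Chebyshev_inequality) (auto simp: Z_def[abs_def])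
  also have "variance (\<lambda>\<omega>. \<Sum>j\<in>I. Z j \<omega>) = (\<Sum>i\<in>I. expectation (\<lambda>\<omega>. (Z i \<omega>)\<^sup>2))"
    unfolding e using expectation_sum_power2_indep(2)[OF I indZ intZ meanZ] by simp
  also have "\<dots> \<le> \<mu>"
    using sum_mono[of I "\<lambda>i. expectation (\<lambda>\<omega>. (Z i \<omega>)\<^sup>2)" "\<lambda>_. m"] varZ by (simp add: \<mu>_def m_def)
  finally show ?thesis
    unfolding sumZ e using a by (simp add: divide_right_mono)
qed

text \<open>A deviation of size \<open>e * c n\<close> has probability at most
  \<open>\<mu> n / c n\<close>, which converges, divided by \<open>c n\<close> times the square of
  \<open>e\<close>, which tends to infinity.\<close>

lemma (in prob_space) iid_triangular_law_of_large_numbers: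
  fixes T :: "nat \<Rightarrow> 'a \<Rightarrow> real" and g :: "nat \<Rightarrow> real \<Rightarrow> real"
  assumes ind: "indep_vars (\<lambda>_. borel) T UNIV"
    and law: "\<And>i. distr M borel (T i) = D"
    and g: "\<And>n. g n \<in> borel_measurable borel" "\<And>n x. 0 \<le> g n x" "\<And>n x. g n x \<le> 1"
    and c: "filterlim c at_top sequentially"
    and L: "(\<lambda>n. real n * integral\<^sup>L D (g n) / c n) \<longlonglongrightarrow> L"
  shows "((\<lambda>p. (\<Sum>j=1..fst p. g (fst p) (T j (snd p))) / c (fst p)) \<longlongrightarrow> L) (whp M)"
proof -
  have T [measurable]: "T i \<in> borel_measurable M" for i
    using ind by (simp add: indep_vars_def)
  note g(1) [measurable]
  define \<mu> where "\<mu> n = real n * integral\<^sup>L D (g n)" for n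
  define S where "S n \<omega> = (\<Sum>j=1..n. g n (T j \<omega>))" for n \<omega>
  have cpos: "\<forall>\<^sub>F n in sequentially. 0 < c n" using c by (simp add: filterlim_at_top_dense)
  have "((\<lambda>p. (S (fst p) (snd p) - \<mu> (fst p)) / c (fst p)) \<longlongrightarrow> 0) (whp M)"
  proof (rule tendstoI)
    fix e :: real assume e: "e > 0"
    \<comment> \<open>\<open>c n\<close> may fail to be positive for finitely many \<open>n\<close>;
      there the whole space counts as exceptional.\<close>
    define B where "B n = (if 0 < c n then {\<omega> \<in> space M. e * c n \<le> \<bar>S n \<omega> - \<mu> n\<bar>} else space M)" for n
    have "(\<lambda>n. measure M (B n)) \<longlonglongrightarrow> 0"
    proof (rule tendsto_sandwich[OF _ _ tendsto_const])
      show "\<forall>\<^sub>F n in sequentially. prob (B n) \<le> (\<mu> n / c n) / e\<^sup>2 / c n"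
        using cpos
      proof eventually_elim
        case (elim n)
        have "prob (B n) \<le> \<mu> n / (e * c n)\<^sup>2"
          using iid_sum_deviation[OF ind law g(1) g(2) g(3), of "{1..n}" "e * c n" n] elim e
          by (simp add: B_def S_def \<mu>_def)
        also have "\<dots> = (\<mu> n / c n) / e\<^sup>2 / c n" by (simp add: power2_eq_square)
        finally show ?case .
      qed
      have "(\<lambda>n. (\<mu> n / c n) / e\<^sup>2 * inverse (c n)) \<longlonglongrightarrow> L / e\<^sup>2 * 0"
        using L e unfolding \<mu>_def
        by (intro tendsto_mult tendsto_divide tendsto_const tendsto_inverse_0_at_top[OF c]) auto
      then show "(\<lambda>n. (\<mu> n / c n) / e\<^sup>2 / c n) \<longlonglongrightarrow> 0" by (simp add: divide_inverse)
    qed simp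
    moreover have "B n \<in> sets M" for n
      unfolding B_def S_def by simp
    ultimately show "\<forall>\<^sub>F p in whp M. dist ((S (fst p) (snd p) - \<mu> (fst p)) / c (fst p)) 0 < e"
      unfolding eventually_whp by (intro exI[of _ B]) (auto simp: B_def field_simps split: if_splits)
  qed
  moreover have "((\<lambda>p. \<mu> (fst p) / c (fst p)) \<longlongrightarrow> L) (whp M)"
    using filterlim_compose[OF L filterlim_fst_whp] by (simp add: \<mu>_def)
  ultimately have "((\<lambda>p. (S (fst p) (snd p) - \<mu> (fst p)) / c (fst p) + \<mu> (fst p) / c (fst p)) \<longlongrightarrow> 0 + L) (whp M)"
    by (rule tendsto_add)
  then show ?thesis by (simp add: S_def diff_divide_distrib)
qed

section \<open>Order statistics\<close>

text \<open>The decreasing list is cut at its first entry below \<open>v\<close>. The prefix is,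
  with multiplicity, the family of entries that are at least \<open>v\<close>, so its length and sum
  can be computed on the unsorted indices. The rank and sum inequalities that follow only compare
  \<open>k\<close> with this length.\<close>

lemma ordstat_decomp:
  obtains us ws where "rev (sort (map a [1..<Suc n])) = us @ ws"
    "\<And>x. x \<in> set us \<Longrightarrow> v \<le> x" "\<And>x. x \<in> set ws \<Longrightarrow> x < v"
    "length us = card {j \<in> {1..n}. v \<le> a j}"
    "sum_list us = (\<Sum>j \<in> {j \<in> {1..n}. v \<le> a j}. a j)"
proof -
  define xs where "xs = map a [1..<Suc n]"
  define ys where "ys = rev (sort xs)"
  define us where "us = takeWhile (\<lambda>x. v \<le> x) ys"
  define ws where "ws = dropWhile (\<lambda>x. v \<le> x) ys"
  have desc: "sorted_wrt (\<ge>) ys" by (simp add: ys_def sorted_wrt_rev)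
  then have ws: "x < v" if "x \<in> set ws" for x
    using that unfolding ws_def by (induction ys) (fastforce split: if_splits)+
  \<comment> \<open>After the first failure every entry of a decreasing list fails, so the prefix is
    a filter, and its multiset does not depend on the sorting.\<close>
  have us: "us = filter (\<lambda>x. v \<le> x) ys"
    unfolding us_def using ws by (intro takeWhile_eq_filter) (auto simp: ws_def not_le)
  have m: "mset us = mset (filter (\<lambda>x. v \<le> x) xs)"
    by (simp add: us ys_def)
  have f: "filter (\<lambda>x. v \<le> x) xs = map a (filter (\<lambda>j. v \<le> a j) [1..<Suc n])"
    by (simp only: xs_def filter_map comp_def)
  have dist: "distinct (filter (\<lambda>j. v \<le> a j) [1..<Suc n])" by simp
  have st: "set (filter (\<lambda>j. v \<le> a j) [1..<Suc n]) = {j \<in> {1..n}. v \<le> a j}" by auto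
  have "length us = length (filter (\<lambda>j. v \<le> a j) [1..<Suc n])"
    using mset_eq_length[OF m] unfolding f by simp
  also have "\<dots> = card {j \<in> {1..n}. v \<le> a j}"
    using distinct_card[OF dist] unfolding st by simp
  finally have l: "length us = card {j \<in> {1..n}. v \<le> a j}" .
  have "sum_list us = sum_list (map a (filter (\<lambda>j. v \<le> a j) [1..<Suc n]))"
    unfolding f[symmetric] using m by (metis sum_mset_sum_list)
  also have "\<dots> = (\<Sum>j \<in> {j \<in> {1..n}. v \<le> a j}. a j)"
    unfolding st[symmetric] by (rule sum_list_distinct_conv_sum_set[OF dist])
  finally have s: "sum_list us = (\<Sum>j \<in> {j \<in> {1..n}. v \<le> a j}. a j)" .
  show ?thesis
  proof (rule that[of us ws])
    show "rev (sort (map a [1..<Suc n])) = us @ ws" by (simp add: us_def ws_def ys_def xs_def)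
    show "v \<le> x" if "x \<in> set us" for x using that by (auto simp: us)
  qed (fact ws l s)+
qed

lemma ordstat_ge:
  assumes "1 \<le> k" "k \<le> card {j \<in> {1..n}. v \<le> a j}"
  shows "v \<le> ordstat n a k"
proof -
  obtain us ws where d: "rev (sort (map a [1..<Suc n])) = us @ ws" "\<And>x. x \<in> set us \<Longrightarrow> v \<le> x"
    "length us = card {j \<in> {1..n}. v \<le> a j}"
    by (rule ordstat_decomp[of a n v]) blast
  \<comment> \<open>Above \<open>n\<close> the order statistic takes its default value 0, for which
    the bound could fail.\<close>
  have "k \<le> n" using assms(2) card_mono[of "{1..n}" "{j \<in> {1..n}. v \<le> a j}"] by (fastforce intro: order_trans)
  moreover have "k - 1 < length us" using assms d(3) by simp
  ultimately show ?thesis using assms(1) d by (simp add: ordstat_def nth_append)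
qed

lemma ordstat_less:
  assumes "1 \<le> k" "k \<le> n" "card {j \<in> {1..n}. v \<le> a j} < k"
  shows "ordstat n a k < v"
proof -
  obtain us ws where d: "rev (sort (map a [1..<Suc n])) = us @ ws" "\<And>x. x \<in> set ws \<Longrightarrow> x < v"
    "length us = card {j \<in> {1..n}. v \<le> a j}"
    by (rule ordstat_decomp[of a n v]) blast
  have "length us + length ws = n" using arg_cong[OF d(1), of length] by (simp del: upt_Suc)
  then have "k - 1 - length us < length ws" "length us \<le> k - 1" using assms d(3) by linarith+
  then show ?thesis using assms d(1,2) by (simp add: ordstat_def nth_append)
qed

text \<open>Valid for every rank, because the default value 0 lies in the range as well.\<close>

lemma ordstat_bounds:
  assumes "\<And>j. 0 \<le> a j" "\<And>j. a j \<le> b" "0 \<le> b"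
  shows "0 \<le> ordstat n a k" "ordstat n a k \<le> b"
proof -
  have "0 \<le> ordstat n a k \<and> ordstat n a k \<le> b"
  proof (cases "1 \<le> k \<and> k \<le> n")
    case True
    then have "rev (sort (map a [1..<Suc n])) ! (k - 1) \<in> set (rev (sort (map a [1..<Suc n])))"
      by (intro nth_mem) (auto simp del: upt_Suc)
    then have "ordstat n a k \<in> set (rev (sort (map a [1..<Suc n])))"
      using True by (simp add: ordstat_def del: set_rev upt_Suc)
    then show ?thesis using assms by auto
  qed (use assms in \<open>auto simp: ordstat_def\<close>)
  then show "0 \<le> ordstat n a k" "ordstat n a k \<le> b" by auto
qed

lemma sum_ordstat_eq_sum_list_take:
  assumes "k \<le> n"
  shows "(\<Sum>i=1..k. ordstat n a i) = sum_list (take k (rev (sort (map a [1..<Suc n]))))"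
proof -
  let ?ys = "rev (sort (map a [1..<Suc n]))"
  have "(\<Sum>i=1..k. ordstat n a i) = (\<Sum>i=1..k. ?ys ! (i - 1))"
    using assms by (intro sum.cong) (auto simp: ordstat_def)
  also have "\<dots> = (\<Sum>i<k. ?ys ! i)"
    by (rule sum.reindex_bij_witness[of _ Suc "\<lambda>i. i - 1"]) auto
  also have "\<dots> = sum_list (take k ?ys)"
    using assms by (simp add: sum_list_sum_nth atLeast0LessThan)
  finally show ?thesis .
qed

text \<open>The \<open>k\<close> largest entries form a prefix of those at level \<open>v\<close>,
  and the dropped ones are nonnegative. In the reverse bound \<open>sum_ordstat_ge\<close>
  nonnegative entries are added to the full prefix.\<close>

lemma sum_ordstat_le:
  assumes "\<And>j. 0 \<le> a j" "k \<le> card {j \<in> {1..n}. v \<le> a j}"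
  shows "(\<Sum>i=1..k. ordstat n a i) \<le> (\<Sum>j \<in> {j \<in> {1..n}. v \<le> a j}. a j)"
proof -
  obtain us ws where d: "rev (sort (map a [1..<Suc n])) = us @ ws"
    "length us = card {j \<in> {1..n}. v \<le> a j}" "sum_list us = (\<Sum>j \<in> {j \<in> {1..n}. v \<le> a j}. a j)"
    by (rule ordstat_decomp[of a n v]) blast
  have "set us \<subseteq> set (rev (sort (map a [1..<Suc n])))" unfolding d(1) by auto
  then have nn: "0 \<le> x" if "x \<in> set us" for x using that assms(1) by auto
  have kn: "k \<le> n" using assms(2) card_mono[of "{1..n}" "{j \<in> {1..n}. v \<le> a j}"] by (fastforce intro: order_trans)
  have "0 \<le> sum_list (drop k us)" by (intro sum_list_nonneg nn) (auto dest: in_set_dropD)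
  then have "sum_list (take k us) \<le> sum_list us"
    using sum_list_append[of "take k us" "drop k us"] by simp
  then show ?thesis
    unfolding sum_ordstat_eq_sum_list_take[OF kn] d(1) using assms(2) d(2,3) by simp
qed

lemma sum_ordstat_ge:
  assumes "\<And>j. 0 \<le> a j" "k \<le> n" "card {j \<in> {1..n}. v \<le> a j} \<le> k"
  shows "(\<Sum>j \<in> {j \<in> {1..n}. v \<le> a j}. a j) \<le> (\<Sum>i=1..k. ordstat n a i)"
proof -
  obtain us ws where d: "rev (sort (map a [1..<Suc n])) = us @ ws"
    "length us = card {j \<in> {1..n}. v \<le> a j}" "sum_list us = (\<Sum>j \<in> {j \<in> {1..n}. v \<le> a j}. a j)"
    by (rule ordstat_decomp[of a n v]) blast
  have "set ws \<subseteq> set (rev (sort (map a [1..<Suc n])))" unfolding d(1) by auto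
  then have nn: "0 \<le> x" if "x \<in> set ws" for x using that assms(1) by auto
  have "0 \<le> sum_list (take (k - length us) ws)" by (intro sum_list_nonneg nn) (auto dest: in_set_takeD)
  then show ?thesis
    unfolding sum_ordstat_eq_sum_list_take[OF assms(2)] d(1) using assms(3) d(2,3) by simp
qed

section \<open>Laplace integrals of a power law\<close>

text \<open>This is s times the lower incomplete gamma function after integration by parts. The form
  avoids u^(s-1), which is singular at 0 for s < 1, and it is the one that the layer-cake
  computation of a truncated expectation produces.\<close>

definition inc_gamma_by_parts :: "real \<Rightarrow> real \<Rightarrow> real" where
  "inc_gamma_by_parts s y = exp (- y) * y powr s + integral {0..y} (\<lambda>v. exp (- v) * v powr s)"

lemma continuous_on_exp_powr:
  fixes s :: real
  assumes "0 < s"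
  shows "continuous_on {0..} (\<lambda>v. exp (- v) * v powr s)"
  using assms by (intro continuous_intros continuous_on_powr') auto

lemma continuous_on_inc_gamma_by_parts:
  assumes s: "0 < s" and z: "0 \<le> z"
  shows "continuous_on {0..z} (inc_gamma_by_parts s)"
proof -
  have c: "continuous_on {0..z} (\<lambda>v. exp (- v) * v powr s)"
    using continuous_on_exp_powr[OF s] by (rule continuous_on_subset) auto
  show ?thesis
    unfolding inc_gamma_by_parts_def[abs_def]
    by (intro continuous_on_add c indefinite_integral_continuous_1 integrable_continuous_real)
qed

text \<open>Inside the interval the right-hand side has derivative s u^(s-1) e^(-u). As this is
  nonnegative, the fundamental theorem applies with one-sided limits at the endpoints, whether or
  not there is a singularity at 0.\<close>

lemma lower_inc_gamma_eq_inc_gamma_by_parts: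
  assumes s: "0 < s" and y: "0 \<le> y"
  shows "s * lower_inc_gamma s y = inc_gamma_by_parts s y"
proof (cases "y = 0")
  case True
  then show ?thesis by (simp add: lower_inc_gamma_def inc_gamma_by_parts_def zero_ereal_def[symmetric])
next
  case False
  with y have y: "0 < y" by simp
  have c: "continuous_on {0..y} (\<lambda>v. exp (- v) * v powr s)"
    using continuous_on_exp_powr[OF s] by (rule continuous_on_subset) auto
  have deriv: "(inc_gamma_by_parts s has_real_derivative s * (v powr (s - 1) * exp (- v))) (at v)"
    if v: "0 < v" "v < y" for v
  proof -
    have "((\<lambda>u. integral {0..u} (\<lambda>v. exp (- v) * v powr s)) has_real_derivative exp (- v) * v powr s) (at v within {0..y})"
      using v by (intro integral_has_real_derivative[OF c]) auto
    then have "((\<lambda>u. integral {0..u} (\<lambda>v. exp (- v) * v powr s)) has_real_derivative exp (- v) * v powr s) (at v)"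
      using v by (subst (asm) at_within_interior) (auto simp: interior_atLeastAtMost_real)
    moreover have "((\<lambda>v. exp (- v) * v powr s) has_real_derivative
        (- exp (- v)) * v powr s + (s * v powr (s - 1)) * exp (- v)) (at v)"
      using v by (auto intro!: derivative_eq_intros simp: has_real_derivative_powr)
    ultimately have "((\<lambda>y. exp (- y) * y powr s + integral {0..y} (\<lambda>v. exp (- v) * v powr s)) has_real_derivative
        ((- exp (- v)) * v powr s + (s * v powr (s - 1)) * exp (- v)) + exp (- v) * v powr s) (at v)"
      by (rule DERIV_add[rotated])
    then show ?thesis
      unfolding inc_gamma_by_parts_def[abs_def] by (rule DERIV_cong) (simp add: mult_ac)
  qed
  have cont: "continuous_on {0..y} (inc_gamma_by_parts s)"
    using s y by (intro continuous_on_inc_gamma_by_parts) auto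
  have lim: "(inc_gamma_by_parts s \<longlongrightarrow> inc_gamma_by_parts s z) (at z within {0..y})" if "z \<in> {0..y}" for z
    using cont that by (simp add: continuous_on)
  have "(LBINT u=ereal 0..ereal y. s * (u powr (s - 1) * exp (- u))) = inc_gamma_by_parts s y - inc_gamma_by_parts s 0"
  proof (rule interval_integral_FTC_nonneg)
    show "((inc_gamma_by_parts s \<circ> real_of_ereal) \<longlongrightarrow> inc_gamma_by_parts s 0) (at_right (ereal 0))"
    proof -
      have "(inc_gamma_by_parts s \<longlongrightarrow> inc_gamma_by_parts s 0) (at_right 0)"
        using lim[of 0] y by (simp add: at_within_Icc_at_right)
      then show ?thesis by (simp add: ereal_tendsto_simps)
    qed
    show "((inc_gamma_by_parts s \<circ> real_of_ereal) \<longlongrightarrow> inc_gamma_by_parts s y) (at_left (ereal y))"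
    proof -
      have "(inc_gamma_by_parts s \<longlongrightarrow> inc_gamma_by_parts s y) (at_left y)"
        using lim[of y] y by (simp add: at_within_Icc_at_left)
      then show ?thesis by (simp add: ereal_tendsto_simps)
    qed
    show "AE u in lborel. ereal 0 < ereal u \<longrightarrow> ereal u < ereal y \<longrightarrow> 0 \<le> s * (u powr (s - 1) * exp (- u))"
      using s by (intro AE_I2) auto
    show "\<And>u. ereal 0 < ereal u \<Longrightarrow> ereal u < ereal y \<Longrightarrow> isCont (\<lambda>u. s * (u powr (s - 1) * exp (- u))) u"
      by (auto intro!: continuous_intros)
  qed (use y deriv in auto)
  moreover have "inc_gamma_by_parts s 0 = 0" by (simp add: inc_gamma_by_parts_def)
  ultimately show ?thesis unfolding lower_inc_gamma_def by (simp add: zero_ereal_def)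
qed

text \<open>Euler's integral; its integrability later provides the dominating function.\<close>

lemma LBINT_exp_powr:
  fixes s :: real
  assumes "0 < s"
  shows "integrable lborel (\<lambda>v. indicator {0..} v * (exp (- v) * v powr s))"
    and "(\<integral>v. indicator {0..} v * (exp (- v) * v powr s) \<partial>lborel) = Gamma (s + 1)"
proof -
  have "((\<lambda>t. t powr (s + 1 - 1) / exp t) has_integral Gamma (s + 1)) {0..}"
    using assms by (intro Gamma_integral_real) auto
  then have "((\<lambda>v. exp (- v) * v powr s) has_integral Gamma (s + 1)) {0..}"
    by (simp add: exp_minus field_simps)
  from nn_integral_has_integral_lebesgue[OF _ this]
  have "(\<integral>\<^sup>+v. ennreal (indicator {0..} v * (exp (- v) * v powr s)) \<partial>lborel) = ennreal (Gamma (s + 1))"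
    by simp
  moreover have "0 \<le> Gamma (s + 1)" using assms by (intro Gamma_real_nonneg) auto
  ultimately have "has_bochner_integral lborel (\<lambda>v. indicator {0..} v * (exp (- v) * v powr s)) (Gamma (s + 1))"
    by (intro has_bochner_integral_nn_integral) (auto simp: indicator_def)
  then show "integrable lborel (\<lambda>v. indicator {0..} v * (exp (- v) * v powr s))"
    "(\<integral>v. indicator {0..} v * (exp (- v) * v powr s) \<partial>lborel) = Gamma (s + 1)"
    by (auto simp: has_bochner_integral_iff)
qed

lemma LBINT_exp_powr_Icc:
  fixes s y :: real
  assumes "0 < s" "0 \<le> y"
  shows "(\<integral>v. indicator {0..y} v * (exp (- v) * v powr s) \<partial>lborel) = integral {0..y} (\<lambda>v. exp (- v) * v powr s)"
proof -
  have c: "continuous_on {0..y} (\<lambda>v. exp (- v) * v powr s)"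
    using continuous_on_exp_powr[OF assms(1)] by (rule continuous_on_subset) auto
  have "set_integrable lborel {0..y} (\<lambda>v. exp (- v) * v powr s)"
    using c by (rule borel_integrable_atLeastAtMost')
  from set_borel_integral_eq_integral(2)[OF this]
  show ?thesis by (simp add: set_lebesgue_integral_def)
qed

lemma LBINT_exp_atLeast:
  fixes u :: real
  shows "has_bochner_integral lborel (\<lambda>v. indicator {u..} v * exp (- v)) (exp (- u))"
proof (rule has_bochner_integral_nn_integral)
  have "((\<lambda>v::real. - exp (- v)) \<longlongrightarrow> - 0) at_top"
    by (intro tendsto_minus filterlim_compose[OF exp_at_bot filterlim_uminus_at_bot_at_top])
  then have "(\<integral>\<^sup>+v. ennreal (exp (- v)) * indicator {u..} v \<partial>lborel) = ennreal (0 - (- exp (- u)))"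
    by (intro nn_integral_FTC_atLeast) (auto intro!: derivative_eq_intros)
  then show "(\<integral>\<^sup>+v. ennreal (indicator {u..} v * exp (- v)) \<partial>lborel) = ennreal (exp (- u))"
    by (simp add: ennreal_mult' ennreal_indicator mult.commute)
qed auto

lemma LBINT_exp_Icc:
  fixes u y :: real
  assumes "u \<le> y"
  shows "(\<integral>v. indicator {u..y} v * exp (- v) \<partial>lborel) = exp (- u) - exp (- y)"
proof -
  have "(\<integral>v. exp (- v) * indicator {u..y} v \<partial>lborel) = (- exp (- y)) - (- exp (- u))"
    using assms by (intro integral_FTC_Icc_real) (auto intro!: derivative_eq_intros continuous_intros)
  then show ?thesis by (simp add: mult.commute)
qed

lemma measurable_times_fst_atMost_snd [measurable]:
  "Measurable.pred (borel \<Otimes>\<^sub>M borel) (\<lambda>x. b * fst x \<in> {..snd x :: real})"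
  unfolding atMost_iff by measurable

section \<open>Laws whose distribution function behaves like a power at zero\<close>

locale power_law_at_zero = prob_space D for D :: "real measure" +
  fixes s C :: real
  assumes sets_D [simp, measurable_cong]: "sets D = sets borel"
    and AE_nonneg: "AE x in D. 0 \<le> x"
    and s_pos: "0 < s" and C_pos: "0 < C"
    and power_law: "((\<lambda>t. measure D {..t} / t powr s) \<longlongrightarrow> C) (at_right 0)"
begin

lemma space_D [simp]: "space D = UNIV"
  using sets_eq_imp_space_eq[OF sets_D] by simp

text \<open>The asymptotics at 0 become a bound for all t >= 0, as dominated convergence requires.
  For t >= t0 it is enough that a probability is at most 1 <= (t / t0)^s. At t = 0 the bound is 0,
  so the absence of an atom has to be shown.\<close>

lemma cdf_bound: obtains K where "0 < K" "\<And>t. 0 \<le> t \<Longrightarrow> measure D {..t} \<le> K * t powr s"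
proof -
  have "\<forall>\<^sub>F t in at_right 0. measure D {..t} / t powr s < C + 1"
    using power_law by (rule order_tendstoD) simp
  then obtain t0 where t0: "0 < t0" "\<And>t. 0 < t \<Longrightarrow> t < t0 \<Longrightarrow> measure D {..t} / t powr s < C + 1"
    unfolding eventually_at_right_field by auto
  define K where "K = max (C + 1) (1 / t0 powr s)"
  have z: "measure D {..0} \<le> 0"
  proof (rule field_le_epsilon)
    fix e :: real assume e: "0 < e"
    \<comment> \<open>The second entry solves \<open>(C + 1) * t powr s = e\<close>; the first keeps
      \<open>t\<close> below \<open>t0\<close>.\<close>
    define t where "t = min (t0 / 2) ((e / (C + 1)) powr (1 / s))"
    have t: "0 < t" "t < t0" using t0(1) e C_pos by (auto simp: t_def)
    have "measure D {..0} \<le> measure D {..t}" using t by (intro finite_measure_mono) auto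
    also have "\<dots> \<le> (C + 1) * t powr s" using t0(2)[OF t] t by (simp add: pos_divide_less_eq)
    also have "\<dots> \<le> (C + 1) * ((e / (C + 1)) powr (1 / s)) powr s"
      using t C_pos s_pos by (intro mult_left_mono powr_mono2) (auto simp: t_def)
    also have "\<dots> = e" using e C_pos s_pos by (simp add: powr_powr)
    finally show "measure D {..0} \<le> 0 + e" by simp
  qed
  show ?thesis
  proof (rule that[of K])
    show "0 < K" using C_pos by (simp add: K_def)
    fix t :: real assume t: "0 \<le> t"
    consider "t = 0" | "0 < t" "t < t0" | "t0 \<le> t" using t by linarith
    then show "measure D {..t} \<le> K * t powr s"
    proof cases
      case 1
      then show ?thesis using z by simp
    next
      case 2
      have "measure D {..t} \<le> (C + 1) * t powr s" using t0(2)[OF 2] 2 by (simp add: pos_divide_less_eq)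
      also have "\<dots> \<le> K * t powr s" by (intro mult_right_mono) (auto simp: K_def)
      finally show ?thesis .
    next
      case 3
      have "measure D {..t} \<le> 1" by simp
      also have "1 \<le> (t / t0) powr s" using 3 t0(1) s_pos by (intro ge_one_powr_ge_zero) auto
      also have "\<dots> = 1 / t0 powr s * t powr s" using 3 t0(1) by (simp add: powr_divide)
      also have "\<dots> \<le> K * t powr s" by (intro mult_right_mono) (auto simp: K_def)
      finally show ?thesis .
    qed
  qed
qed

lemma scaled_cdf_tendsto:
  assumes b: "filterlim b at_top F" and y: "0 < y"
  shows "((\<lambda>n. measure D {..y / b n} * b n powr s) \<longlongrightarrow> C * y powr s) F"
proof -
  have bp: "\<forall>\<^sub>F n in F. 0 < b n" using b by (simp add: filterlim_at_top_dense)
  have "filterlim (\<lambda>n. y / b n) (at_right 0) F"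
    unfolding filterlim_at
  proof (intro conjI)
    show "((\<lambda>n. y / b n) \<longlongrightarrow> 0) F"
      using tendsto_mult_right_zero[OF tendsto_inverse_0_at_top[OF b], of y] by (simp add: divide_inverse)
    show "\<forall>\<^sub>F n in F. y / b n \<in> {0<..} \<and> y / b n \<noteq> 0"
      using bp by eventually_elim (use y in auto)
  qed
  from filterlim_compose[OF power_law this]
  have "((\<lambda>n. measure D {..y / b n} / (y / b n) powr s * y powr s) \<longlongrightarrow> C * y powr s) F"
    by (rule tendsto_mult_right)
  moreover have "\<forall>\<^sub>F n in F. measure D {..y / b n} / (y / b n) powr s * y powr s = measure D {..y / b n} * b n powr s"
    using bp by eventually_elim (use y in \<open>simp add: powr_divide\<close>)
  ultimately show ?thesis by (rule Lim_transform_eventually)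
qed

lemma cdf_borel [measurable]: "(\<lambda>v. measure D {..v}) \<in> borel_measurable borel"
  by (intro borel_measurable_mono monoI finite_measure_mono) auto

text \<open>Layer-cake formula: \<open>exp (- x)\<close> is the integral of \<open>exp (- v)\<close> over \<open>v \<ge> x\<close>.\<close>

lemma integral_layer_cake:
  assumes b: "0 < b" and I [measurable]: "I \<in> sets borel" "I \<subseteq> {0..}"
  shows "(\<integral>x. (\<integral>v. indicator I v * (exp (- v) * indicator {..v} (b * x)) \<partial>lborel) \<partial>D) =
    (\<integral>v. indicator I v * (exp (- v) * measure D {..v / b}) \<partial>lborel)"
proof -
  interpret P: pair_sigma_finite D lborel ..
  have "integrable (D \<Otimes>\<^sub>M lborel) (\<lambda>(x, v). indicator {0..} v * exp (- v) :: real)"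
    using LBINT_exp_atLeast[of 0]
    by (intro P.Fubini_integrable) (auto simp: has_bochner_integral_iff abs_mult)
  then have int: "integrable (D \<Otimes>\<^sub>M lborel) (\<lambda>(x, v). indicator I v * (exp (- v) * indicator {..v} (b * x)) :: real)"
  proof (rule Bochner_Integration.integrable_bound)
    show "AE z in D \<Otimes>\<^sub>M lborel. norm ((\<lambda>(x, v). indicator I v * (exp (- v) * indicator {..v} (b * x)) :: real) z) \<le>
        norm ((\<lambda>(x, v). indicator {0..} v * exp (- v) :: real) z)"
      using I(2) by (intro AE_I2) (auto simp: indicator_def)
  qed measurable
  have "(\<integral>x. (\<integral>v. indicator I v * (exp (- v) * indicator {..v} (b * x)) \<partial>lborel) \<partial>D) =
     (\<integral>v. (\<integral>x. indicator I v * (exp (- v) * indicator {..v} (b * x)) \<partial>D) \<partial>lborel)"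
    using P.Fubini_integral[OF int] by simp
  also have "\<dots> = (\<integral>v. indicator I v * (exp (- v) * measure D {..v / b}) \<partial>lborel)"
  proof (intro Bochner_Integration.integral_cong refl)
    fix v :: real
    have "(\<integral>x. indicator I v * (exp (- v) * indicator {..v} (b * x)) \<partial>D) =
       indicator I v * (exp (- v) * (\<integral>x. indicator {..v / b} x \<partial>D))"
      using b by (simp add: indicator_def field_simps)
    then show "(\<integral>x. indicator I v * (exp (- v) * indicator {..v} (b * x)) \<partial>D) =
       indicator I v * (exp (- v) * measure D {..v / b})" by simp
  qed
  finally show ?thesis .
qed

text \<open>Dominated convergence: the distribution function at v / \<beta>, times \<beta>^s, tends
  to C v^s for v > 0 and is at most K v^s, because \<beta> cancels in K (v / \<beta>)^s
  \<beta>^s.\<close>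

lemma scaled_layer_cake_tendsto:
  fixes \<beta> :: "nat \<Rightarrow> real"
  assumes \<beta>: "\<And>n. 0 < \<beta> n" "filterlim \<beta> at_top sequentially"
    and I [measurable]: "I \<in> sets borel" "I \<subseteq> {0..}"
  shows "(\<lambda>n. (\<integral>v. indicator I v * (exp (- v) * measure D {..v / \<beta> n}) \<partial>lborel) * \<beta> n powr s) \<longlonglongrightarrow>
    C * (\<integral>v. indicator I v * (exp (- v) * v powr s) \<partial>lborel)"
proof -
  obtain K where K: "0 < K" "\<And>t. 0 \<le> t \<Longrightarrow> measure D {..t} \<le> K * t powr s"
    by (rule cdf_bound) blast
  define f where "f n v = indicator I v * (exp (- v) * (measure D {..v / \<beta> n} * \<beta> n powr s))" for n v
  have "(\<lambda>n. integral\<^sup>L lborel (f n)) \<longlonglongrightarrow> (\<integral>v. indicator I v * (exp (- v) * (C * v powr s)) \<partial>lborel)"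
  proof (rule integral_dominated_convergence)
    show "integrable lborel (\<lambda>v. K * (indicator {0..} v * (exp (- v) * v powr s)))"
      using LBINT_exp_powr(1)[OF s_pos] by (rule integrable_mult_right)
    show "AE v in lborel. (\<lambda>n. f n v) \<longlonglongrightarrow> indicator I v * (exp (- v) * (C * v powr s))"
    proof (rule AE_mp[OF AE_lborel_singleton[of 0]], intro AE_I2 impI)
      fix v :: real assume "v \<noteq> 0"
      show "(\<lambda>n. f n v) \<longlonglongrightarrow> indicator I v * (exp (- v) * (C * v powr s))"
      proof (cases "v \<in> I")
        case True
        with I(2) \<open>v \<noteq> 0\<close> have "0 < v" by force
        then show ?thesis unfolding f_def by (intro tendsto_mult tendsto_const scaled_cdf_tendsto \<beta>(2))
      qed (simp add: f_def)
    qed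
    show "AE v in lborel. norm (f n v) \<le> K * (indicator {0..} v * (exp (- v) * v powr s))" for n
    proof (rule AE_I2)
      fix v :: real
      show "norm (f n v) \<le> K * (indicator {0..} v * (exp (- v) * v powr s))"
      proof (cases "v \<in> I")
        case True
        with I(2) have v: "0 \<le> v" by force
        have "measure D {..v / \<beta> n} * \<beta> n powr s \<le> (K * (v / \<beta> n) powr s) * \<beta> n powr s"
          using K(2)[of "v / \<beta> n"] v \<beta>(1)[of n] by (intro mult_right_mono) auto
        also have "\<dots> = K * v powr s" using v \<beta>(1)[of n] by (simp add: powr_divide)
        finally have "exp (- v) * (measure D {..v / \<beta> n} * \<beta> n powr s) \<le> exp (- v) * (K * v powr s)"
          by (intro mult_left_mono) auto
        then show ?thesis using True v by (simp add: f_def abs_mult mult_ac)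
      qed (use K(1) in \<open>simp add: f_def\<close>)
    qed
  qed (auto simp: f_def[abs_def])
  moreover have "integral\<^sup>L lborel (f n) =
      (\<integral>v. indicator I v * (exp (- v) * measure D {..v / \<beta> n}) \<partial>lborel) * \<beta> n powr s" for n
    unfolding integral_mult_left_zero[symmetric] f_def[abs_def] by (simp only: mult.assoc)
  moreover have "(\<integral>v. indicator I v * (exp (- v) * (C * v powr s)) \<partial>lborel) =
      C * (\<integral>v. indicator I v * (exp (- v) * v powr s) \<partial>lborel)"
    unfolding integral_mult_right_zero[symmetric] by (simp only: mult.assoc mult.left_commute)
  ultimately show ?thesis by simp
qed

text \<open>The layer cake over all levels v >= 0. The guard \<open>0 <= x\<close> changes nothing
  almost surely and keeps the function within [0, 1] on the whole line, as the law of large numbers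
  demands.\<close>

lemma scaled_expectation_exp_tendsto:
  fixes \<beta> :: "nat \<Rightarrow> real"
  assumes \<beta>: "\<And>n. 0 < \<beta> n" "filterlim \<beta> at_top sequentially"
  shows "(\<lambda>n. (\<integral>x. (if 0 \<le> x then exp (- (\<beta> n * x)) else 0) \<partial>D) * \<beta> n powr s) \<longlonglongrightarrow> C * Gamma (s + 1)"
proof -
  have "(\<integral>x. (if 0 \<le> x then exp (- (b * x)) else 0) \<partial>D) =
      (\<integral>v. indicator {0..} v * (exp (- v) * measure D {..v / b}) \<partial>lborel)" if b: "0 < b" for b
  proof -
    have "(\<integral>x. (if 0 \<le> x then exp (- (b * x)) else 0) \<partial>D) =
      (\<integral>x. (\<integral>v. indicator {0..} v * (exp (- v) * indicator {..v} (b * x)) \<partial>lborel) \<partial>D)"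
    proof (rule integral_cong_AE)
      show "AE x in D. (if 0 \<le> x then exp (- (b * x)) else 0) =
          (\<integral>v. indicator {0..} v * (exp (- v) * indicator {..v} (b * x)) \<partial>lborel)"
        using AE_nonneg
      proof eventually_elim
        case (elim x)
        then have "(\<lambda>v. indicator {0..} v * (exp (- v) * indicator {..v} (b * x))) = (\<lambda>v. indicator {b * x..} v * exp (- v))"
          using b by (auto simp: indicator_def fun_eq_iff intro: order_trans[rotated])
        with elim show ?case using LBINT_exp_atLeast[of "b * x"] by (simp add: has_bochner_integral_iff)
      qed
    qed measurable
    also have "\<dots> = (\<integral>v. indicator {0..} v * (exp (- v) * measure D {..v / b}) \<partial>lborel)"
      by (rule integral_layer_cake[OF b]) auto
    finally show ?thesis .
  qed
  with scaled_layer_cake_tendsto[OF \<beta>, of "{0..}"] \<beta>(1) LBINT_exp_powr(2)[OF s_pos]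
  show ?thesis by simp
qed

text \<open>For b x <= y, e^(-b x) is e^(-y) plus the integral of e^(-v) over [b x, y]. The two
  parts give the boundary term and the integral term of \<open>inc_gamma_by_parts\<close>.\<close>

lemma scaled_truncated_expectation_exp_tendsto:
  fixes \<beta> :: "nat \<Rightarrow> real"
  assumes \<beta>: "\<And>n. 0 < \<beta> n" "filterlim \<beta> at_top sequentially" and y: "0 < y"
  shows "(\<lambda>n. (\<integral>x. (if 0 \<le> x \<and> \<beta> n * x \<le> y then exp (- (\<beta> n * x)) else 0) \<partial>D) * \<beta> n powr s) \<longlonglongrightarrow>
    C * inc_gamma_by_parts s y"
proof -
  have eq: "(\<integral>x. (if 0 \<le> x \<and> b * x \<le> y then exp (- (b * x)) else 0) \<partial>D) =
      exp (- y) * measure D {..y / b} +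
      (\<integral>v. indicator {0..y} v * (exp (- v) * measure D {..v / b}) \<partial>lborel)" if b: "0 < b" for b
  proof -
    have inner: "(\<integral>v. indicator {0..y} v * (exp (- v) * indicator {..v} (b * x)) \<partial>lborel) =
        (if b * x \<le> y then exp (- (b * x)) - exp (- y) else 0)" if "0 \<le> x" for x
    proof (cases "b * x \<le> y")
      case True
      have "0 \<le> b * x" using b that by simp
      then have "(\<lambda>v. indicator {0..y} v * (exp (- v) * indicator {..v} (b * x))) = (\<lambda>v. indicator {b * x..y} v * exp (- v))"
        by (auto simp: indicator_def fun_eq_iff)
      then show ?thesis using True LBINT_exp_Icc[OF True] by simp
    next
      case False
      then have "(\<lambda>v. indicator {0..y} v * (exp (- v) * indicator {..v} (b * x))) = (\<lambda>v. 0::real)"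
        by (auto simp: indicator_def fun_eq_iff)
      then show ?thesis using False by simp
    qed
    have m [measurable]: "(\<lambda>x. \<integral>v. indicator {0..y} v * (exp (- v) * indicator {..v} (b * x)) \<partial>lborel) \<in> borel_measurable borel"
      by measurable
    have "(\<integral>x. (if 0 \<le> x \<and> b * x \<le> y then exp (- (b * x)) else 0) \<partial>D) =
      (\<integral>x. exp (- y) * indicator {..y / b} x +
        (\<integral>v. indicator {0..y} v * (exp (- v) * indicator {..v} (b * x)) \<partial>lborel) \<partial>D)"
    proof (rule integral_cong_AE)
      show "AE x in D. (if 0 \<le> x \<and> b * x \<le> y then exp (- (b * x)) else 0) =
        exp (- y) * indicator {..y / b} x +
        (\<integral>v. indicator {0..y} v * (exp (- v) * indicator {..v} (b * x)) \<partial>lborel)"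
        using AE_nonneg
      proof eventually_elim
        case (elim x)
        have "indicator {..y / b} x = (if b * x \<le> y then 1 else 0 :: real)"
          using b by (simp add: indicator_def pos_le_divide_eq mult.commute)
        then show ?case using elim by (simp add: inner)
      qed
    qed measurable
    also have "\<dots> = (\<integral>x. exp (- y) * indicator {..y / b} x \<partial>D) +
        (\<integral>x. (\<integral>v. indicator {0..y} v * (exp (- v) * indicator {..v} (b * x)) \<partial>lborel) \<partial>D)"
    proof (rule Bochner_Integration.integral_add)
      show "integrable D (\<lambda>x. exp (- y) * indicator {..y / b} x)"
        by (intro integrable_const_bound[of _ "exp (- y)"]) (auto simp: indicator_def)
      show "integrable D (\<lambda>x. \<integral>v. indicator {0..y} v * (exp (- v) * indicator {..v} (b * x)) \<partial>lborel)"
      proof (rule integrable_const_bound[of _ 1])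
        show "AE x in D. norm (\<integral>v. indicator {0..y} v * (exp (- v) * indicator {..v} (b * x)) \<partial>lborel) \<le> (1::real)"
          using AE_nonneg
        proof eventually_elim
          case (elim x)
          show ?case
          proof (cases "b * x \<le> y")
            case True
            have "exp (- (b * x)) \<le> 1" "exp (- y) \<le> exp (- (b * x))" "0 \<le> exp (- y)"
              using elim b True by auto
            then have "\<bar>exp (- (b * x)) - exp (- y)\<bar> \<le> 1" by linarith
            then show ?thesis unfolding inner[OF elim] using True by simp
          next
            case False
            then show ?thesis unfolding inner[OF elim] by simp
          qed
        qed
      qed simp
    qed
    also have "(\<integral>x. exp (- y) * indicator {..y / b} x \<partial>D) = exp (- y) * measure D {..y / b}"
      by simp
    also have "(\<integral>x. (\<integral>v. indicator {0..y} v * (exp (- v) * indicator {..v} (b * x)) \<partial>lborel) \<partial>D) =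
        (\<integral>v. indicator {0..y} v * (exp (- v) * measure D {..v / b}) \<partial>lborel)"
      by (rule integral_layer_cake[OF b]) auto
    finally show ?thesis .
  qed
  have "(\<lambda>n. exp (- y) * (measure D {..y / \<beta> n} * \<beta> n powr s) +
      (\<integral>v. indicator {0..y} v * (exp (- v) * measure D {..v / \<beta> n}) \<partial>lborel) * \<beta> n powr s)
    \<longlonglongrightarrow> exp (- y) * (C * y powr s) + C * (\<integral>v. indicator {0..y} v * (exp (- v) * v powr s) \<partial>lborel)"
    by (intro tendsto_add tendsto_mult tendsto_const scaled_cdf_tendsto scaled_layer_cake_tendsto \<beta> y) auto
  moreover have "exp (- y) * (C * y powr s) + C * (\<integral>v. indicator {0..y} v * (exp (- v) * v powr s) \<partial>lborel) =
      C * inc_gamma_by_parts s y"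
    using y LBINT_exp_powr_Icc[OF s_pos, of y] by (simp add: inc_gamma_by_parts_def algebra_simps)
  ultimately show ?thesis by (simp only: eq[OF \<beta>(1)] distrib_right mult.assoc)
qed

end

section \<open>Order statistics of softmax weights\<close>

definition softmax :: "real \<Rightarrow> (nat \<Rightarrow> real) \<Rightarrow> nat \<Rightarrow> nat \<Rightarrow> real" where
  "softmax b t n i = exp (- (b * t i)) / (\<Sum>j=1..n. exp (- (b * t j)))"

lemma attn_eq_softmax: "attn b q x n = softmax b (\<lambda>j. 1 - inner q (x j)) n"
  by (simp add: fun_eq_iff attn_def softmax_def)

context
  fixes b :: real and t :: "nat \<Rightarrow> real" and n :: nat
  assumes n: "1 \<le> n"
begin

private abbreviation "Z \<equiv> \<Sum>j=1..n. exp (- (b * t j))"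
private abbreviation "J y \<equiv> {j \<in> {1..n}. b * t j \<le> y}"

lemma softmax_denominator_pos: "0 < Z"
  using n by (intro sum_pos) auto

lemma softmax_nonneg: "0 \<le> softmax b t n j"
  using softmax_denominator_pos by (simp add: softmax_def)

text \<open>A common denominator preserves order, so a threshold on the weights becomes one on
  \<open>b * t j\<close> in which \<open>Z\<close> no longer occurs. The bounds that follow use this
  threshold and are multiplied through by \<open>Z\<close>.\<close>

lemma softmax_level_set: "{j \<in> {1..n}. exp (- y) / Z \<le> softmax b t n j} = J y"
  using softmax_denominator_pos by (auto simp: softmax_def divide_le_cancel)

lemma sum_softmax_level_set: "Z * (\<Sum>j\<in>J y. softmax b t n j) = (\<Sum>j\<in>J y. exp (- (b * t j)))"
  using softmax_denominator_pos by (simp add: softmax_def sum_distrib_left del: sum_divide_distrib)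

lemma ordstat_softmax_ge:
  assumes "1 \<le> k" "k \<le> card (J y)"
  shows "exp (- y) \<le> Z * ordstat n (softmax b t n) k"
  using ordstat_ge[of k n "exp (- y) / Z" "softmax b t n"] assms softmax_denominator_pos
  unfolding softmax_level_set by (simp add: pos_divide_le_eq mult.commute)

lemma ordstat_softmax_less:
  assumes "1 \<le> k" "k \<le> n" "card (J y) < k"
  shows "Z * ordstat n (softmax b t n) k < exp (- y)"
  using ordstat_less[of k n "exp (- y) / Z" "softmax b t n"] assms softmax_denominator_pos
  unfolding softmax_level_set by (simp add: pos_less_divide_eq mult.commute)

lemma ordstat_softmax_bounds:
  assumes "0 \<le> b" "\<And>j. 0 \<le> t j"
  shows "0 \<le> ordstat n (softmax b t n) k" "Z * ordstat n (softmax b t n) k \<le> 1"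
proof -
  have "softmax b t n j \<le> 1 / Z" for j
    using softmax_denominator_pos assms unfolding softmax_def by (intro divide_right_mono) auto
  note * = ordstat_bounds[of "softmax b t n", OF softmax_nonneg this]
  show "0 \<le> ordstat n (softmax b t n) k" "Z * ordstat n (softmax b t n) k \<le> 1"
    using * softmax_denominator_pos by (simp_all add: pos_le_divide_eq mult.commute)
qed

lemma sum_ordstat_softmax_le:
  assumes "k \<le> card (J y)"
  shows "Z * (\<Sum>i=1..k. ordstat n (softmax b t n) i) \<le> (\<Sum>j\<in>J y. exp (- (b * t j)))"
  using mult_left_mono[OF sum_ordstat_le[of "softmax b t n" k n "exp (- y) / Z", OF softmax_nonneg], of Z]
    assms softmax_denominator_pos
  unfolding softmax_level_set sum_softmax_level_set by simp

lemma sum_ordstat_softmax_ge: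
  assumes "k \<le> n" "card (J y) \<le> k"
  shows "(\<Sum>j\<in>J y. exp (- (b * t j))) \<le> Z * (\<Sum>i=1..k. ordstat n (softmax b t n) i)"
  using mult_left_mono[OF sum_ordstat_ge[of "softmax b t n" k n "exp (- y) / Z", OF softmax_nonneg], of Z]
    assms softmax_denominator_pos
  unfolding softmax_level_set sum_softmax_level_set by simp

end

section \<open>Weights with a power law at zero\<close>

text \<open>\<open>subcritical\<close> is the smallness condition on \<beta>, raised to the power
  -s. Divergence of \<beta> enters only in an inner context, because the vanishing of single weights
  also covers bounded \<beta>.\<close>

locale iid_softmax = prob_space M + L: power_law_at_zero D s C
  for M :: "'a measure" and D s C +
  fixes T :: "nat \<Rightarrow> 'a \<Rightarrow> real" and \<beta> :: "nat \<Rightarrow> real"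
  assumes indep_T: "indep_vars (\<lambda>_. borel) T UNIV"
    and law_T: "\<And>i. distr M borel (T i) = D"
    and T_nonneg: "\<And>i \<omega>. \<omega> \<in> space M \<Longrightarrow> 0 \<le> T i \<omega>"
    and \<beta>_pos: "\<And>n. 0 < \<beta> n"
    and subcritical: "filterlim (\<lambda>n. real n * \<beta> n powr (- s)) at_top sequentially"
begin

definition m :: "nat \<Rightarrow> real" where "m n = C * real n * \<beta> n powr (- s)"

definition Z :: "nat \<times> 'a \<Rightarrow> real" where
  "Z p = (\<Sum>j=1..fst p. exp (- (\<beta> (fst p) * T j (snd p))))"

definition J :: "real \<Rightarrow> nat \<times> 'a \<Rightarrow> nat set" where
  "J y p = {j \<in> {1..fst p}. \<beta> (fst p) * T j (snd p) \<le> y}"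

definition S :: "real \<Rightarrow> nat \<times> 'a \<Rightarrow> real" where
  "S y p = (\<Sum>j\<in>J y p. exp (- (\<beta> (fst p) * T j (snd p))))"

text \<open>\<open>W k (n, \<omega>)\<close> is the order statistic \<open>A\<^sub>(\<^sub>k\<^sub>)\<close> of sample size \<open>n\<close>.\<close>

definition W :: "nat \<Rightarrow> nat \<times> 'a \<Rightarrow> real" where
  "W k p = ordstat (fst p) (softmax (\<beta> (fst p)) (\<lambda>j. T j (snd p)) (fst p)) k"

lemma m_at_top: "filterlim m at_top sequentially"
  using filterlim_tendsto_pos_mult_at_top[OF tendsto_const L.C_pos subcritical]
  by (simp add: m_def[abs_def] mult.assoc)

lemma m_pos: "1 \<le> n \<Longrightarrow> 0 < m n"
  using L.C_pos \<beta>_pos[of n] by (simp add: m_def)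

lemma eventually_whp_good: "\<forall>\<^sub>F p in whp M. 1 \<le> fst p \<and> snd p \<in> space M"
  by (rule eventually_whp_sequentially) (auto intro: eventually_mono[OF eventually_ge_at_top[of 1]])

lemma whp_tendsto_fst: "(f \<longlongrightarrow> l) sequentially \<Longrightarrow> ((\<lambda>p. f (fst p)) \<longlongrightarrow> l) (whp M)"
  by (rule filterlim_compose[OF _ filterlim_fst_whp])

text \<open>The constant C is part of \<open>m\<close>, so a limit C l of scaled expectations
  becomes l.\<close>

lemma sum_div_m_tendsto:
  assumes g: "\<And>n. g n \<in> borel_measurable borel" "\<And>n x. 0 \<le> g n x" "\<And>n x. g n x \<le> 1"
    and lim: "(\<lambda>n. integral\<^sup>L D (g n) * \<beta> n powr s) \<longlonglongrightarrow> C * l"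
  shows "((\<lambda>p. (\<Sum>j=1..fst p. g (fst p) (T j (snd p))) / m (fst p)) \<longlongrightarrow> l) (whp M)"
proof (rule iid_triangular_law_of_large_numbers[OF indep_T law_T g m_at_top])
  have "(\<lambda>n. integral\<^sup>L D (g n) * \<beta> n powr s / C) \<longlonglongrightarrow> C * l / C"
    using lim L.C_pos by (intro tendsto_divide) auto
  then have "(\<lambda>n. integral\<^sup>L D (g n) * \<beta> n powr s / C) \<longlonglongrightarrow> l"
    using L.C_pos by simp
  moreover have "\<forall>\<^sub>F n in sequentially. integral\<^sup>L D (g n) * \<beta> n powr s / C = real n * integral\<^sup>L D (g n) / m n"
    using eventually_ge_at_top[of 1]
  proof eventually_elim
    case (elim n)
    then show ?case by (simp add: m_def powr_minus field_simps)
  qed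
  ultimately show "(\<lambda>n. real n * integral\<^sup>L D (g n) / m n) \<longlonglongrightarrow> l"
    by (rule Lim_transform_eventually)
qed

lemma level_count_sum:
  "real (card (J y p)) = (\<Sum>j=1..fst p. indicator {..y / \<beta> (fst p)} (T j (snd p)))"
proof -
  have "(\<Sum>j=1..fst p. indicator {..y / \<beta> (fst p)} (T j (snd p))) = (\<Sum>j\<in>J y p. 1::real)"
    using \<beta>_pos[of "fst p"]
    by (intro sum.mono_neutral_cong_right) (auto simp: J_def indicator_def pos_le_divide_eq mult.commute)
  then show ?thesis by simp
qed

text \<open>Each point with \<beta> T <= 1 adds at least e^(-1) to \<open>Z\<close>, while
  \<open>Z p * W i p\<close> is at most 1. Hence \<open>W i p\<close> is at most e divided by the
  number of such points, which tends to infinity in probability.\<close>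

lemma top_weight_tendsto_0:
  assumes "1 \<le> i"
  shows "((\<lambda>p. W i p) \<longlongrightarrow> 0) (whp M)"
proof -
  \<comment> \<open>The exact mean of the count: with this normalisation the limit is 1, whatever
    \<beta> does.\<close>
  define c where "c n = real n * measure D {..1 / \<beta> n}" for n
  obtain t0 where t0: "0 < t0" "\<And>t. 0 < t \<Longrightarrow> t < t0 \<Longrightarrow> C / 2 < measure D {..t} / t powr s"
    using order_tendstoD(1)[OF L.power_law, of "C / 2"] L.C_pos unfolding eventually_at_right_field by auto
  \<comment> \<open>The power-law lower bound holds only below \<open>t0\<close>, whereas 1 /
    \<beta> may be large. Capping at \<open>t0 / 2\<close> and monotonicity give a bound for every
    \<open>n\<close>.\<close>
  have lower: "C / 2 * min (\<beta> n powr (- s)) ((t0 / 2) powr s) \<le> measure D {..1 / \<beta> n}" for n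
  proof -
    define u where "u = min (1 / \<beta> n) (t0 / 2)"
    have u: "0 < u" "u < t0" "u \<le> 1 / \<beta> n" using t0(1) \<beta>_pos[of n] by (auto simp: u_def)
    have "min (\<beta> n powr (- s)) ((t0 / 2) powr s) \<le> u powr s"
      using \<beta>_pos[of n] by (auto simp: u_def min_def powr_minus powr_divide inverse_eq_divide)
    then have "C / 2 * min (\<beta> n powr (- s)) ((t0 / 2) powr s) \<le> C / 2 * u powr s"
      using L.C_pos by (intro mult_left_mono) auto
    also have "\<dots> \<le> measure D {..u}"
      using t0(2)[OF u(1,2)] u(1) by (simp add: pos_less_divide_eq)
    also have "\<dots> \<le> measure D {..1 / \<beta> n}"
      using u(3) by (intro L.finite_measure_mono) auto
    finally show ?thesis .
  qed
  have c: "filterlim c at_top sequentially"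
  proof -
    have A: "filterlim (\<lambda>n. C / 2 * (real n * \<beta> n powr (- s))) at_top sequentially"
      using L.C_pos by (intro filterlim_tendsto_pos_mult_at_top[OF tendsto_const _ subcritical]) auto
    have B: "filterlim (\<lambda>n. C / 2 * (t0 / 2) powr s * real n) at_top sequentially"
      using L.C_pos t0(1) by (intro filterlim_tendsto_pos_mult_at_top[OF tendsto_const _ filterlim_real_sequentially]) auto
    \<comment> \<open>For each \<open>n\<close> the minimum is one of its two entries; multiplied by
      \<open>n\<close>, both diverge.\<close>
    have "\<forall>\<^sub>F n in sequentially. K \<le> c n" for K
      using A[unfolded filterlim_at_top, rule_format, of K] B[unfolded filterlim_at_top, rule_format, of K]
    proof eventually_elim
      case (elim n)
      have "K \<le> real n * (C / 2 * min (\<beta> n powr (- s)) ((t0 / 2) powr s))"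
        using elim by (auto simp: min_def mult_ac)
      also have "\<dots> \<le> c n" unfolding c_def by (intro mult_left_mono lower) auto
      finally show ?case .
    qed
    then show ?thesis by (simp add: filterlim_at_top)
  qed
  have "(\<lambda>n. real n * integral\<^sup>L D (indicator {..1 / \<beta> n}) / c n) \<longlonglongrightarrow> 1"
  proof (rule tendsto_eventually)
    have "\<forall>\<^sub>F n in sequentially. 0 < c n" using c by (simp add: filterlim_at_top_dense)
    then show "\<forall>\<^sub>F n in sequentially. real n * integral\<^sup>L D (indicator {..1 / \<beta> n}) / c n = 1"
      by eventually_elim (auto simp: c_def zero_less_mult_iff)
  qed
  from iid_triangular_law_of_large_numbers[OF indep_T law_T _ _ _ c this]
  have count: "((\<lambda>p. real (card (J 1 p)) / c (fst p)) \<longlongrightarrow> 1) (whp M)"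
    by (simp add: level_count_sum)
  have c': "filterlim (\<lambda>p. c (fst p)) at_top (whp M)"
    by (rule filterlim_compose[OF c filterlim_fst_whp])
  have "filterlim (\<lambda>p. real (card (J 1 p)) / c (fst p) * c (fst p)) at_top (whp M)"
    by (rule filterlim_tendsto_pos_mult_at_top[OF count _ c']) simp
  moreover have "\<forall>\<^sub>F p in whp M. 0 < c (fst p)" using c' by (simp add: filterlim_at_top_dense)
  ultimately have N: "filterlim (\<lambda>p. real (card (J 1 p))) at_top (whp M)"
    by (subst filterlim_cong[OF refl refl, where g="\<lambda>p. real (card (J 1 p)) / c (fst p) * c (fst p)"])
       (auto elim: eventually_mono)
  show ?thesis
  proof (rule tendsto_sandwich[OF _ _ tendsto_const])
    show "((\<lambda>p. exp 1 * inverse (real (card (J 1 p)))) \<longlongrightarrow> 0) (whp M)"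
      using tendsto_mult_right_zero[OF tendsto_inverse_0_at_top[OF N]] by simp
    show "\<forall>\<^sub>F p in whp M. 0 \<le> W i p"
      using eventually_whp_good
    proof eventually_elim
      case (elim p)
      then show ?case
        unfolding W_def using \<beta>_pos[of "fst p"] T_nonneg by (intro ordstat_softmax_bounds(1)) (auto simp: less_imp_le)
    qed
    have "\<forall>\<^sub>F p in whp M. 0 < real (card (J 1 p))" using N unfolding filterlim_at_top_dense by blast
    with eventually_whp_good show "\<forall>\<^sub>F p in whp M. W i p \<le> exp 1 * inverse (real (card (J 1 p)))"
    proof eventually_elim
      case (elim p)
      have Wn: "0 \<le> W i p"
        unfolding W_def using elim \<beta>_pos[of "fst p"] T_nonneg by (intro ordstat_softmax_bounds(1)) (auto simp: less_imp_le)
      have ZW: "Z p * W i p \<le> 1"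
        unfolding W_def Z_def using elim \<beta>_pos[of "fst p"] T_nonneg by (intro ordstat_softmax_bounds(2)) (auto simp: less_imp_le)
      have "real (card (J 1 p)) * exp (- 1) = (\<Sum>j\<in>J 1 p. exp (- 1))" by simp
      also have "\<dots> \<le> (\<Sum>j\<in>J 1 p. exp (- (\<beta> (fst p) * T j (snd p))))"
        by (intro sum_mono) (simp add: J_def)
      also have "\<dots> \<le> Z p" unfolding Z_def by (intro sum_mono2) (auto simp: J_def)
      finally have "real (card (J 1 p)) * exp (- 1) * W i p \<le> 1"
        using mult_right_mono[OF _ Wn] ZW by (meson order_trans)
      then have "real (card (J 1 p)) * W i p \<le> exp 1" by (simp add: exp_minus field_simps)
      then show ?case using elim by (simp add: divide_inverse[symmetric] pos_le_divide_eq mult.commute)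
    qed
  qed
qed

section \<open>Limits at scale 1 / \<beta> when \<beta> tends to infinity\<close>

context
  assumes \<beta>_at_top: "filterlim \<beta> at_top sequentially"
begin

lemma Z_tendsto: "((\<lambda>p. Z p / m (fst p)) \<longlongrightarrow> Gamma (s + 1)) (whp M)"
proof -
  have "((\<lambda>p. (\<Sum>j=1..fst p. if 0 \<le> T j (snd p) then exp (- (\<beta> (fst p) * T j (snd p))) else 0) / m (fst p))
      \<longlongrightarrow> Gamma (s + 1)) (whp M)"
    using \<beta>_pos L.scaled_expectation_exp_tendsto[OF \<beta>_pos \<beta>_at_top]
    by (intro sum_div_m_tendsto) (auto simp: less_imp_le)
  moreover have "\<forall>\<^sub>F p in whp M. (\<Sum>j=1..fst p. if 0 \<le> T j (snd p) then exp (- (\<beta> (fst p) * T j (snd p))) else 0) / m (fst p)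
      = Z p / m (fst p)"
    using eventually_whp_good by eventually_elim (simp add: Z_def T_nonneg)
  ultimately show ?thesis by (rule Lim_transform_eventually)
qed

lemma level_count_tendsto:
  assumes y: "0 < y"
  shows "((\<lambda>p. real (card (J y p)) / m (fst p)) \<longlongrightarrow> y powr s) (whp M)"
proof -
  have "(\<lambda>n. integral\<^sup>L D (indicator {..y / \<beta> n}) * \<beta> n powr s) \<longlonglongrightarrow> C * y powr s"
    using L.scaled_cdf_tendsto[OF \<beta>_at_top y] by simp
  from sum_div_m_tendsto[OF _ _ _ this] show ?thesis
    by (simp add: level_count_sum)
qed

lemma S_tendsto:
  assumes y: "0 < y"
  shows "((\<lambda>p. S y p / m (fst p)) \<longlongrightarrow> inc_gamma_by_parts s y) (whp M)"
proof -
  let ?g = "\<lambda>n x. if 0 \<le> x \<and> \<beta> n * x \<le> y then exp (- (\<beta> n * x)) else 0"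
  have "((\<lambda>p. (\<Sum>j=1..fst p. ?g (fst p) (T j (snd p))) / m (fst p)) \<longlongrightarrow> inc_gamma_by_parts s y) (whp M)"
    using \<beta>_pos L.scaled_truncated_expectation_exp_tendsto[OF \<beta>_pos \<beta>_at_top y]
    by (intro sum_div_m_tendsto) (auto simp: less_imp_le)
  moreover have "\<forall>\<^sub>F p in whp M. (\<Sum>j=1..fst p. ?g (fst p) (T j (snd p))) / m (fst p) = S y p / m (fst p)"
    using eventually_whp_good
  proof eventually_elim
    case (elim p)
    have "(\<Sum>j=1..fst p. ?g (fst p) (T j (snd p))) = S y p"
      unfolding S_def using elim T_nonneg by (intro sum.mono_neutral_cong_right) (auto simp: J_def)
    then show ?case by simp
  qed
  ultimately show ?thesis by (rule Lim_transform_eventually)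
qed

text \<open>Writing the rank limit as \<open>Y powr s\<close> makes \<open>Y\<close> the level of
  \<beta> T that separates the first \<open>k n\<close> points from the rest.\<close>

context
  fixes k :: "nat \<Rightarrow> nat" and x Y :: real
  assumes k: "\<And>n. 1 \<le> k n" and Y: "0 \<le> Y" and x: "x = Y powr s"
    and k_lim: "(\<lambda>n. real (k n) / m n) \<longlonglongrightarrow> x"
begin

lemma eventually_rank_le_level_count:
  assumes "Y < y"
  shows "\<forall>\<^sub>F p in whp M. k (fst p) \<le> card (J y p)"
proof -
  have "((\<lambda>p. real (card (J y p)) / m (fst p) - real (k (fst p)) / m (fst p)) \<longlongrightarrow> y powr s - x) (whp M)"
    using assms Y by (intro tendsto_diff level_count_tendsto whp_tendsto_fst[OF k_lim]) auto
  moreover have "0 < y powr s - x"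
    using assms Y L.s_pos by (simp add: x powr_less_mono2)
  ultimately have "\<forall>\<^sub>F p in whp M. 0 < real (card (J y p)) / m (fst p) - real (k (fst p)) / m (fst p)"
    by (rule order_tendstoD(1))
  with eventually_whp_good show ?thesis
  proof eventually_elim
    case (elim p)
    then have "0 < (real (card (J y p)) - real (k (fst p))) / m (fst p)" by (simp add: diff_divide_distrib)
    then show ?case using m_pos[of "fst p"] elim by (simp add: zero_less_divide_iff)
  qed
qed

lemma eventually_level_count_less_rank:
  assumes "0 < y" "y < Y"
  shows "\<forall>\<^sub>F p in whp M. card (J y p) < k (fst p)"
proof -
  have "((\<lambda>p. real (k (fst p)) / m (fst p) - real (card (J y p)) / m (fst p)) \<longlongrightarrow> x - y powr s) (whp M)"
    using assms by (intro tendsto_diff level_count_tendsto whp_tendsto_fst[OF k_lim]) auto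
  moreover have "0 < x - y powr s"
    using assms L.s_pos by (simp add: x powr_less_mono2)
  ultimately have "\<forall>\<^sub>F p in whp M. 0 < real (k (fst p)) / m (fst p) - real (card (J y p)) / m (fst p)"
    by (rule order_tendstoD(1))
  with eventually_whp_good show ?thesis
  proof eventually_elim
    case (elim p)
    then have "0 < (real (k (fst p)) - real (card (J y p))) / m (fst p)" by (simp add: diff_divide_distrib)
    then show ?case using m_pos[of "fst p"] elim by (simp add: zero_less_divide_iff)
  qed
qed

text \<open>Excludes ranks at which the order statistic is 0 by default. The rank lies below a level
  count, and such a count never exceeds the sample size.\<close>

lemma eventually_rank_le: "\<forall>\<^sub>F p in whp M. k (fst p) \<le> fst p"
proof -
  have "\<forall>\<^sub>F p in whp M. k (fst p) \<le> card (J (Y + 1) p)"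
    by (rule eventually_rank_le_level_count) simp
  then show ?thesis
  proof eventually_elim
    case (elim p)
    have "card (J (Y + 1) p) \<le> card {1..fst p}" by (intro card_mono) (auto simp: J_def)
    with elim show ?case by simp
  qed
qed

lemma ZW_tendsto: "((\<lambda>p. Z p * W (k (fst p)) p) \<longlongrightarrow> exp (- Y)) (whp M)"
proof (rule order_tendstoI)
  fix a assume a: "a < exp (- Y)"
  have "((\<lambda>y. exp (- y)) \<longlongrightarrow> exp (- Y)) (at_right Y)" by (intro tendsto_intros)
  then have "\<forall>\<^sub>F y in at_right Y. a < exp (- y)" using a by (rule order_tendstoD(1))
  then obtain y where y: "Y < y" "a < exp (- y)"
    unfolding eventually_at_right_field by (meson dense)
  from eventually_rank_le_level_count[OF y(1)] eventually_whp_good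
  show "\<forall>\<^sub>F p in whp M. a < Z p * W (k (fst p)) p"
  proof eventually_elim
    case (elim p)
    have "exp (- y) \<le> Z p * W (k (fst p)) p"
      unfolding Z_def W_def using elim k by (intro ordstat_softmax_ge) (auto simp: J_def)
    with y show ?case by simp
  qed
next
  fix a assume a: "exp (- Y) < a"
  show "\<forall>\<^sub>F p in whp M. Z p * W (k (fst p)) p < a"
  \<comment> \<open>No positive level lies below \<open>Y = 0\<close>; there the trivial bound 1 =
    e^0 replaces the count.\<close>
  proof (cases "Y = 0")
    case True
    show ?thesis using eventually_whp_good
    proof eventually_elim
      case (elim p)
      have "Z p * W (k (fst p)) p \<le> 1"
        unfolding W_def Z_def using elim \<beta>_pos[of "fst p"] T_nonneg by (intro ordstat_softmax_bounds(2)) (auto simp: less_imp_le)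
      with a True show ?case by simp
    qed
  next
    case False
    with Y have Y': "0 < Y" by simp
    have "((\<lambda>y. exp (- y)) \<longlongrightarrow> exp (- Y)) (at_left Y)" by (intro tendsto_intros)
    then have "\<forall>\<^sub>F y in at_left Y. exp (- y) < a" using a by (rule order_tendstoD(2))
    moreover have "\<forall>\<^sub>F y in at_left Y. y \<in> {0<..<Y}" by (rule eventually_at_left_real[OF Y'])
    ultimately have "\<forall>\<^sub>F y in at_left Y. exp (- y) < a \<and> y \<in> {0<..<Y}" by eventually_elim simp
    then obtain y where y: "0 < y" "y < Y" "exp (- y) < a"
      using eventually_happens[of _ "at_left Y"] trivial_limit_at_left_real[of Y] by force
    from eventually_level_count_less_rank[OF y(1,2)] eventually_whp_good eventually_rank_le
    show ?thesis
    proof eventually_elim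
      case (elim p)
      have "Z p * W (k (fst p)) p < exp (- y)"
        unfolding Z_def W_def using elim k by (intro ordstat_softmax_less) (auto simp: J_def)
      with y show ?case by simp
    qed
  qed
qed

text \<open>Level sets slightly larger and slightly smaller than the first \<open>k n\<close> points
  bound the partial sum from above and below; continuity of \<open>inc_gamma_by_parts\<close>
  absorbs the shift of level.\<close>

lemma Z_sum_W_tendsto:
  "((\<lambda>p. Z p * (\<Sum>i=1..k (fst p). W i p) / m (fst p)) \<longlongrightarrow> inc_gamma_by_parts s Y) (whp M)"
proof (rule order_tendstoI)
  let ?R = "\<lambda>p. Z p * (\<Sum>i=1..k (fst p). W i p)"
  have cont: "continuous_on {0..Y + 1} (inc_gamma_by_parts s)"
    using Y by (intro continuous_on_inc_gamma_by_parts[OF L.s_pos]) auto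
  fix a assume a: "inc_gamma_by_parts s Y < a"
  have "(inc_gamma_by_parts s \<longlongrightarrow> inc_gamma_by_parts s Y) (at Y within {Y..Y + 1})"
    using cont Y by (auto simp: continuous_on intro: tendsto_within_subset[where S="{0..Y + 1}"])
  then have "(inc_gamma_by_parts s \<longlongrightarrow> inc_gamma_by_parts s Y) (at_right Y)"
    by (simp add: at_within_Icc_at_right)
  then have "\<forall>\<^sub>F y in at_right Y. inc_gamma_by_parts s y < a" using a by (rule order_tendstoD(2))
  then obtain y where y: "Y < y" "inc_gamma_by_parts s y < a"
    unfolding eventually_at_right_field by (meson dense)
  have "((\<lambda>p. S y p / m (fst p)) \<longlongrightarrow> inc_gamma_by_parts s y) (whp M)"
    using y Y by (intro S_tendsto) simp
  then have "\<forall>\<^sub>F p in whp M. S y p / m (fst p) < a" using y(2) by (rule order_tendstoD(2))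
  with eventually_rank_le_level_count[OF y(1)] eventually_whp_good
  show "\<forall>\<^sub>F p in whp M. ?R p / m (fst p) < a"
  proof eventually_elim
    case (elim p)
    have "?R p \<le> S y p"
      unfolding Z_def W_def S_def J_def using elim by (intro sum_ordstat_softmax_le) (auto simp: J_def)
    then have "?R p / m (fst p) \<le> S y p / m (fst p)"
      using m_pos[of "fst p"] elim by (intro divide_right_mono) auto
    with elim show ?case by simp
  qed
next
  let ?R = "\<lambda>p. Z p * (\<Sum>i=1..k (fst p). W i p)"
  fix a assume a: "a < inc_gamma_by_parts s Y"
  show "\<forall>\<^sub>F p in whp M. a < ?R p / m (fst p)"
  \<comment> \<open>Again no positive level is available below \<open>Y\<close>; the limit is 0
    here, and nonnegativity of the weights suffices.\<close>
  proof (cases "Y = 0")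
    case True
    then have "a < 0" using a by (simp add: inc_gamma_by_parts_def)
    show ?thesis using eventually_whp_good
    proof eventually_elim
      case (elim p)
      have "0 \<le> W i p" for i
        unfolding W_def using elim \<beta>_pos[of "fst p"] T_nonneg by (intro ordstat_softmax_bounds(1)) (auto simp: less_imp_le)
      moreover have "0 \<le> Z p" by (simp add: Z_def sum_nonneg)
      ultimately have "0 \<le> ?R p / m (fst p)"
        using m_pos[of "fst p"] elim by (intro divide_nonneg_pos mult_nonneg_nonneg sum_nonneg) auto
      with \<open>a < 0\<close> show ?case by simp
    qed
  next
    case False
    with Y have Y': "0 < Y" by simp
    have "(inc_gamma_by_parts s \<longlongrightarrow> inc_gamma_by_parts s Y) (at Y within {0..Y})"
      using continuous_on_inc_gamma_by_parts[OF L.s_pos Y] Y by (simp add: continuous_on)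
    then have "(inc_gamma_by_parts s \<longlongrightarrow> inc_gamma_by_parts s Y) (at_left Y)"
      using Y' by (simp add: at_within_Icc_at_left)
    then have "\<forall>\<^sub>F y in at_left Y. a < inc_gamma_by_parts s y" using a by (rule order_tendstoD(1))
    moreover have "\<forall>\<^sub>F y in at_left Y. y \<in> {0<..<Y}" by (rule eventually_at_left_real[OF Y'])
    ultimately have "\<forall>\<^sub>F y in at_left Y. a < inc_gamma_by_parts s y \<and> y \<in> {0<..<Y}" by eventually_elim simp
    then obtain y where y: "0 < y" "y < Y" "a < inc_gamma_by_parts s y"
      using eventually_happens[of _ "at_left Y"] trivial_limit_at_left_real[of Y] by force
    have "\<forall>\<^sub>F p in whp M. a < S y p / m (fst p)"
      using S_tendsto[OF y(1)] y(3) by (rule order_tendstoD(1))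
    with eventually_level_count_less_rank[OF y(1,2)] eventually_whp_good eventually_rank_le
    show ?thesis
    proof eventually_elim
      case (elim p)
      have "S y p \<le> ?R p"
        unfolding Z_def W_def S_def J_def using elim by (intro sum_ordstat_softmax_ge) (auto simp: J_def)
      then have "S y p / m (fst p) \<le> ?R p / m (fst p)"
        using m_pos[of "fst p"] elim by (intro divide_right_mono) auto
      with elim show ?case by simp
    qed
  qed
qed

end

text \<open>Makes rank 1 the case \<open>Y = 0\<close> of a general rank, since
  \<open>0 powr s\<close> is 0; consequently Z A_(1) tends to 1.\<close>

lemma inverse_m_tendsto_0: "(\<lambda>n. real 1 / m n) \<longlonglongrightarrow> 0 powr s"
  using tendsto_inverse_0_at_top[OF m_at_top] by (simp add: divide_inverse)

lemma eventually_Z_pos: "\<forall>\<^sub>F p in whp M. 0 < Z p \<and> 0 < m (fst p)"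
  using eventually_whp_good unfolding Z_def by eventually_elim (intro conjI softmax_denominator_pos m_pos; simp)

lemma Gamma_s1_pos: "0 < Gamma (s + 1)"
  using L.s_pos by (intro Gamma_real_pos) auto

text \<open>Each claim is a quotient of two known limits in which \<open>Z\<close> cancels: Z A_(k)
  by Z A_(1), Z A_(k) by Z / m, and Z / m times the partial sum by Z / m.\<close>

lemma order_statistics_limits:
  assumes k: "\<And>n. 1 \<le> k n" and Y: "0 \<le> Y" and k_lim: "(\<lambda>n. real (k n) / m n) \<longlonglongrightarrow> Y powr s"
  shows "((\<lambda>p. W (k (fst p)) p / W 1 p) \<longlongrightarrow> exp (- Y)) (whp M)"
    and "((\<lambda>p. m (fst p) * W (k (fst p)) p) \<longlongrightarrow> exp (- Y) / Gamma (s + 1)) (whp M)"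
    and "((\<lambda>p. \<Sum>i=1..k (fst p). W i p) \<longlongrightarrow> lower_inc_gamma s Y / Gamma s) (whp M)"
proof -
  have k_lim1: "((\<lambda>p. Z p * W (k (fst p)) p) \<longlongrightarrow> exp (- Y)) (whp M)"
    by (rule ZW_tendsto[OF k Y refl k_lim])
  have "((\<lambda>p. Z p * W ((\<lambda>_. 1) (fst p)) p) \<longlongrightarrow> exp (- 0)) (whp M)"
    by (rule ZW_tendsto[OF _ _ refl inverse_m_tendsto_0]) auto
  then have one: "((\<lambda>p. Z p * W 1 p) \<longlongrightarrow> 1) (whp M)" by simp
  have "((\<lambda>p. (Z p * W (k (fst p)) p) / (Z p * W 1 p)) \<longlongrightarrow> exp (- Y) / 1) (whp M)"
    by (intro tendsto_divide k_lim1 one) simp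
  moreover have "\<forall>\<^sub>F p in whp M. (Z p * W (k (fst p)) p) / (Z p * W 1 p) = W (k (fst p)) p / W 1 p"
    using eventually_Z_pos by eventually_elim simp
  ultimately show "((\<lambda>p. W (k (fst p)) p / W 1 p) \<longlongrightarrow> exp (- Y)) (whp M)"
    using Lim_transform_eventually by fastforce
  have "((\<lambda>p. (Z p * W (k (fst p)) p) / (Z p / m (fst p))) \<longlongrightarrow> exp (- Y) / Gamma (s + 1)) (whp M)"
    using Gamma_s1_pos by (intro tendsto_divide k_lim1 Z_tendsto) simp
  moreover have "\<forall>\<^sub>F p in whp M. (Z p * W (k (fst p)) p) / (Z p / m (fst p)) = m (fst p) * W (k (fst p)) p"
    using eventually_Z_pos by eventually_elim simp
  ultimately show "((\<lambda>p. m (fst p) * W (k (fst p)) p) \<longlongrightarrow> exp (- Y) / Gamma (s + 1)) (whp M)"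
    by (rule Lim_transform_eventually)
  have "((\<lambda>p. (Z p * (\<Sum>i=1..k (fst p). W i p) / m (fst p)) / (Z p / m (fst p))) \<longlongrightarrow> inc_gamma_by_parts s Y / Gamma (s + 1)) (whp M)"
    using Gamma_s1_pos by (intro tendsto_divide Z_sum_W_tendsto[OF k Y refl k_lim] Z_tendsto) simp
  moreover have "\<forall>\<^sub>F p in whp M. (Z p * (\<Sum>i=1..k (fst p). W i p) / m (fst p)) / (Z p / m (fst p)) = (\<Sum>i=1..k (fst p). W i p)"
    using eventually_Z_pos by eventually_elim simp
  ultimately have "((\<lambda>p. \<Sum>i=1..k (fst p). W i p) \<longlongrightarrow> inc_gamma_by_parts s Y / Gamma (s + 1)) (whp M)"
    by (rule Lim_transform_eventually)
  \<comment> \<open>Numerator and denominator both carry a factor s.\<close>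
  moreover have "inc_gamma_by_parts s Y / Gamma (s + 1) = lower_inc_gamma s Y / Gamma s"
  proof -
    have "Gamma (s + 1) = s * Gamma s"
      using L.s_pos by (intro Gamma_plus1) (auto elim: nonpos_Ints_cases)
    then show ?thesis
      using L.s_pos lower_inc_gamma_eq_inc_gamma_by_parts[OF L.s_pos Y, symmetric] by simp
  qed
  ultimately show "((\<lambda>p. \<Sum>i=1..k (fst p). W i p) \<longlongrightarrow> lower_inc_gamma s Y / Gamma s) (whp M)"
    by simp
qed

end

end

text \<open>Raise \<beta> n^(-1/s) to the power s and invert: a positive sequence tending to 0 turns
  into one tending to infinity.\<close>

lemma powr_subcritical_at_top:
  fixes \<beta> :: "nat \<Rightarrow> real"
  assumes s: "0 < s" and \<beta>: "\<And>n. 0 < \<beta> n" and lim: "(\<lambda>n. \<beta> n * real n powr (- (1 / s))) \<longlonglongrightarrow> 0"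
  shows "filterlim (\<lambda>n. real n * \<beta> n powr (- s)) at_top sequentially"
proof -
  have "(\<lambda>n. (\<beta> n * real n powr (- (1 / s))) powr s) \<longlonglongrightarrow> 0 powr s"
    using s \<beta> by (intro tendsto_powr' lim tendsto_const) (auto simp: less_imp_le)
  then have "filterlim (\<lambda>n. inverse ((\<beta> n * real n powr (- (1 / s))) powr s)) at_top sequentially"
  proof (intro filterlim_inverse_at_top)
    show "\<forall>\<^sub>F n in sequentially. 0 < (\<beta> n * real n powr (- (1 / s))) powr s"
      using eventually_ge_at_top[of 1]
    proof eventually_elim
      case (elim n)
      then show ?case using \<beta>[of n] by simp
    qed
  qed simp
  moreover have "\<forall>\<^sub>F n in sequentially. inverse ((\<beta> n * real n powr (- (1 / s))) powr s) = real n * \<beta> n powr (- s)"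
    using eventually_ge_at_top[of 1]
  proof eventually_elim
    case (elim n)
    have "(\<beta> n * real n powr (- (1 / s))) powr s = \<beta> n powr s * inverse (real n)"
    proof -
      have "(real n powr (- (1 / s))) powr s = real n powr (- 1)"
        unfolding powr_powr using s by simp
      then show ?thesis using elim by (simp add: powr_mult powr_minus)
    qed
    then show ?case by (simp add: powr_minus mult.commute)
  qed
  ultimately show ?thesis using filterlim_cong[OF refl refl] by fast
qed

theorem mainTheorem3:
  fixes M :: "'a measure"
    and X :: "nat \<Rightarrow> 'a \<Rightarrow> real^'d::finite"
    and \<rho> :: "real^'d \<Rightarrow> real"
    and q :: "real^'d"
    and \<beta> :: "nat \<Rightarrow> real"
  defines "\<alpha> \<equiv> 2 / (real CARD('d) - 1)"
  defines "Cq \<equiv> 2 powr (1 / \<alpha>) * sphere_area (CARD('d) - 2) / (real CARD('d) - 1) * \<rho> q"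
  defines "A \<equiv> (\<lambda>k n \<omega>. ord_attn (\<beta> n) q (\<lambda>j. X j \<omega>) n k)"
  assumes dim: "CARD('d) \<ge> 2"
    and q_sphere: "q \<in> sphere 0 1"
    \<comment> \<open>rho is a C^2 probability density on the sphere w.r.t. surface measure\<close>
    and rho_meas: "\<rho> \<in> borel_measurable borel"
    and rho_nonneg: "\<forall>x\<in>sphere 0 1. \<rho> x \<ge> 0"
    and rho_prob: "(\<integral>\<^sup>+x. ennreal (\<rho> x) \<partial>sphere_measure) = 1"
    and rho_C2: "\<exists>U g Dg D2g. open U \<and> sphere 0 1 \<subseteq> U \<and> (\<forall>x\<in>sphere 0 1. g x = \<rho> x) \<and>
                   (\<forall>x\<in>U. (g has_derivative blinfun_apply (Dg x)) (at x)) \<and>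
                   (\<forall>x\<in>U. (Dg has_derivative blinfun_apply (D2g x)) (at x)) \<and>
                   continuous_on U D2g"
    and rho_q: "\<rho> q > 0"
    \<comment> \<open>x_1, x_2, ... i.i.d. on the sphere with law rho d sigma\<close>
    and prob: "prob_space M"
    and indep: "prob_space.indep_vars M (\<lambda>_. borel) X UNIV"
    and on_sphere: "\<forall>i. \<forall>\<omega>\<in>space M. X i \<omega> \<in> sphere 0 1"
    and law: "\<forall>i. distr M borel (X i) = density sphere_measure (\<lambda>x. ennreal (\<rho> x))"
    and beta_pos: "\<forall>n. \<beta> n > 0"
    and beta_small: "(\<lambda>n. \<beta> n * real n powr (- \<alpha>)) \<longlonglongrightarrow> 0"
  shows "(\<forall>i\<ge>1. conv_in_prob M (A i) 0) \<and>
         (filterlim \<beta> at_top sequentially \<longrightarrow>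
           (\<forall>(k :: nat \<Rightarrow> nat) (x :: real).
              (\<forall>n. k n \<ge> 1) \<longrightarrow> x \<ge> 0 \<longrightarrow>
              ((\<lambda>n. real (k n) / (Cq * real n * \<beta> n powr (- 1 / \<alpha>))) \<longlonglongrightarrow> x) \<longrightarrow>
                conv_in_prob M (\<lambda>n \<omega>. A (k n) n \<omega> / A 1 n \<omega>) (exp (- (x powr \<alpha>)))
              \<and> conv_in_prob M (\<lambda>n \<omega>. Cq * real n * \<beta> n powr (- 1 / \<alpha>) * A (k n) n \<omega>)
                  (exp (- (x powr \<alpha>)) / Gamma (1 / \<alpha> + 1))
              \<and> conv_in_prob M (\<lambda>n \<omega>. \<Sum>i=1..k n. A i n \<omega>)
                  (lower_inc_gamma (1 / \<alpha>) (x powr \<alpha>) / Gamma (1 / \<alpha>))))"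
proof -
  interpret prob_space M by (rule prob)
  define s where "s = (real CARD('d) - 1) / 2"
  define T where "T j \<omega> = 1 - inner q (X j \<omega>)" for j \<omega>
  define D where "D = distr (density sphere_measure (\<lambda>x. ennreal (\<rho> x))) borel (\<lambda>x. 1 - inner q x)"
  have s: "0 < s" using dim by (simp add: s_def)
  have \<alpha>: "\<alpha> = 1 / s" by (simp add: \<alpha>_def s_def)
  have nq: "norm q = 1" using q_sphere by simp
  have X [measurable]: "X i \<in> borel_measurable M" for i
    using indep by (simp add: indep_vars_def)
  have T [measurable]: "T i \<in> borel_measurable M" for i unfolding T_def[abs_def] by measurable
  have law_T: "distr M borel (T i) = D" for i
    unfolding D_def law[rule_format, of i, symmetric]
    by (subst distr_distr) (auto simp: comp_def T_def[abs_def])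
  have indep_T: "indep_vars (\<lambda>_. borel) T UNIV"
  proof -
    have "indep_vars (\<lambda>_. borel) (\<lambda>i. (\<lambda>x. 1 - inner q x) \<circ> X i) UNIV"
      using indep by (intro indep_vars_compose[where M'="\<lambda>_. borel"]) auto
    then show ?thesis by (simp add: T_def[abs_def] comp_def)
  qed
  have T_nonneg: "0 \<le> T i \<omega>" if "\<omega> \<in> space M" for i \<omega>
    using norm_cauchy_schwarz[of q "X i \<omega>"] on_sphere that nq by (auto simp: T_def)
  have cdf: "measure D {..t} = measure (density sphere_measure (\<lambda>x. ennreal (\<rho> x))) (sphere_cap q t)" for t
  proof -
    \<comment> \<open>Index 0 represents the common law. Passing through \<open>X 0\<close>, which
      lies on the sphere surely, supplies the norm condition contained in
      \<open>sphere_cap\<close>.\<close>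
    have "measure D {..t} = measure M (T 0 -` {..t} \<inter> space M)"
      unfolding law_T[of 0, symmetric] by (rule measure_distr) auto
    also have "T 0 -` {..t} \<inter> space M = X 0 -` sphere_cap q t \<inter> space M"
      using on_sphere by (auto simp: T_def sphere_cap_def)
    also have "measure M \<dots> = measure (distr M borel (X 0)) (sphere_cap q t)"
      by (rule measure_distr[symmetric]) auto
    finally show ?thesis using law by simp
  qed
  have cont: "continuous (at q within sphere 0 1) \<rho>"
  proof -
    obtain U g Dg D2g where U: "open U" "sphere 0 1 \<subseteq> U" "\<forall>x\<in>sphere 0 1. g x = \<rho> x"
      "\<forall>x\<in>U. (g has_derivative blinfun_apply (Dg x)) (at x)"
      using rho_C2 by (elim exE conjE)
    have "continuous_on (sphere 0 1) g"
      using U by (intro continuous_at_imp_continuous_on) (auto dest: has_derivative_continuous)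
    then have "continuous_on (sphere 0 1) \<rho>"
      using U(3) by (subst continuous_on_cong[OF refl, of _ _ g]) auto
    then show ?thesis using q_sphere by (simp add: continuous_on_eq_continuous_within)
  qed
  have Cq: "Cq = unit_ball_vol (CARD('d) - 1) * 2 powr s * \<rho> q"
    unfolding Cq_def unit_ball_vol_eq_sphere_area[OF dim] by (simp add: \<alpha>)
  have pD: "prob_space D" unfolding law_T[of 0, symmetric] by (rule prob_space_distr) simp
  interpret iid_softmax M D s Cq T \<beta>
  proof (intro iid_softmax.intro power_law_at_zero.intro power_law_at_zero_axioms.intro iid_softmax_axioms.intro prob pD indep_T law_T s)
    show "sets D = sets borel" by (simp add: D_def)
    show "AE x in D. 0 \<le> x"
      unfolding law_T[of 0, symmetric] using T_nonneg by (subst AE_distr_iff) auto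
    show "0 < Cq" unfolding Cq using rho_q by simp
    show "((\<lambda>t. measure D {..t} / t powr s) \<longlongrightarrow> Cq) (at_right 0)"
      unfolding cdf Cq s_def using rho_nonneg by (intro measure_density_sphere_cap_asymp nq rho_meas cont) simp
    show "filterlim (\<lambda>n. real n * \<beta> n powr (- s)) at_top sequentially"
      using beta_small beta_pos unfolding \<alpha> by (intro powr_subcritical_at_top s) auto
  qed (use T_nonneg beta_pos in auto)
  have AW: "A k n \<omega> = W k (n, \<omega>)" for k n \<omega>
    unfolding A_def ord_attn_def attn_eq_softmax W_def by (simp add: T_def)
  have "conv_in_prob M (A i) 0" if "1 \<le> i" for i
    using top_weight_tendsto_0[OF that] by (intro conv_in_prob_whp) (simp add: AW)
  moreover have "conv_in_prob M (\<lambda>n \<omega>. A (k n) n \<omega> / A 1 n \<omega>) (exp (- (x powr \<alpha>)))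
              \<and> conv_in_prob M (\<lambda>n \<omega>. Cq * real n * \<beta> n powr (- 1 / \<alpha>) * A (k n) n \<omega>)
                  (exp (- (x powr \<alpha>)) / Gamma (1 / \<alpha> + 1))
              \<and> conv_in_prob M (\<lambda>n \<omega>. \<Sum>i=1..k n. A i n \<omega>)
                  (lower_inc_gamma (1 / \<alpha>) (x powr \<alpha>) / Gamma (1 / \<alpha>))"
    if b: "filterlim \<beta> at_top sequentially" and k: "\<forall>n. 1 \<le> k n" and x: "0 \<le> x"
      and lim: "(\<lambda>n. real (k n) / (Cq * real n * \<beta> n powr (- 1 / \<alpha>))) \<longlonglongrightarrow> x" for k :: "nat \<Rightarrow> nat" and x
  proof -
    have e: "- 1 / \<alpha> = - s" "1 / \<alpha> = s" by (simp_all add: \<alpha>)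
    \<comment> \<open>The level is \<open>Y = x powr \<alpha>\<close>; its power s is x because
      \<alpha> s = 1 and x >= 0.\<close>
    have "(\<lambda>n. real (k n) / m n) \<longlonglongrightarrow> (x powr \<alpha>) powr s"
      using lim x s unfolding e m_def by (simp add: \<alpha> powr_powr)
    note * = order_statistics_limits[OF b k[rule_format] powr_ge_zero this]
    show ?thesis
      unfolding e using * by (intro conjI conv_in_prob_whp) (simp_all add: AW m_def)
  qed
  ultimately show ?thesis by blast
qed

end
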